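(* Let $C\geq1$ be an absolute constant such that for all $n,d$ and every $g\colon\{-1,1\}^n\to\{-1,0,1\}$, $g\not\equiv0$, computable by a depth-$d$ decision tree, with $q=\Pr_x[g(x)\ne0]$, one has $\|L_1g\|\le\binom d1^{1/2}Cq\sqrt{\ln(e/q)}$ and $\|L_2g\|\le\binom d2^{1/2}C^2q\sqrt{\ln(e/q)}\sqrt{\ln(en/q)}$. Let $n,d\ge1$ be integers, $0\le p\le1$, $T\in\mathcal T^*(n,d,p,0)$, and let $k$ be an integer with $1\le k\le d$. Then every elementary family $\mathcal E\subseteq\mathcal P_{d,k}$ satisfies \[ \|T|_{\mathcal E}\|\le(12C)^k\Lambda_{n^2,k}(p)\sqrt{|\mathcal E|}. \]
   Context: Decision trees: a decision tree of depth $d$ in variables $x_1,\dots,x_n\in\{-1,1\}$ is a function $T$ on strings $v\in\{-1,1\}^{\le d}$ (the empty string is the root) such that for $|v|\le d-1$, $T(v)\in\{1,\dots,n\}$ is the index of the variable queried at node $v$, with $T(\varepsilon),T(v_1),\dots,T(v_1\cdots v_{d-1})$ pairwise distinct for each $v\in\{-1,1\}^{d-1}$; and for each leaf $v\in\{-1,1\}^d$, $T(v)$ is a real multilinear polynomial in $x_1,\dots,x_n$ not involving $x_{T(\varepsilon)},\dots,x_{T(v_1\cdots v_{d-1})}$. The density of $T$ is the fraction of leaves with nonzero label. $\mathcal T^*(n,d,p,0)$ is the set of depth-$d$ trees in $n$ variables with density $p$ whose leaf labels lie in $\{-1,0,1\}$. For a family $\mathcal S$ of subsets of $\{1,\dots,d\}$,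 $T|_{\mathcal S}(x)=\sum_{S\in\mathcal S}\sum_{v\in\{-1,1\}^d}T(v)\,2^{-d}\prod_{i\in S}v_ix_{T(v_1\cdots v_{i-1})}$. $\mathcal P_{d,k}$ is the family of $k$-subsets of $\{1,\dots,d\}$. For $\phi\colon\{-1,1\}^n\to\mathbb R$, $\|\phi\|$ is the sum of absolute values of its Fourier coefficients and $L_k\phi$ its degree-$k$ homogeneous Fourier part. An integer interval is a finite (possibly empty) set of consecutive integers; $\binom Ij$ is the family of $j$-subsets of $I$; $\mathcal A*\mathcal B=\{A\cup B:A\in\mathcal A,B\in\mathcal B\}$; an elementary family is any family $\binom{I_1}{k_1}*\cdots*\binom{I_\ell}{k_\ell}$ with $\ell\ge1$, pairwise disjoint integer intervals $I_j$, and $k_j\in\{0,1,2\}$. For positive integers $m,k$: $\Lambda_{m,k}(0)=0$; $\Lambda_{m,k}(p)=p\sqrt{(\frac1k\ln\frac{e^km^{k-1}}p)^k}$ for $0<p\le1/m$; $\Lambda_{m,k}(p)=p\sqrt{\ln\frac ep(\ln em)^{k-1}}$ for $1/m<p\le1$. *)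

theory Defs
  imports Complex_Main "HOL-Library.FuncSet" "HOL-Library.Disjoint_Sets"
begin

definition hypercube :: "nat \<Rightarrow> (nat \<Rightarrow> real) set" where
  "hypercube n = {1..n} \<rightarrow>\<^sub>E {-1, 1}"

text \<open>Functions on the hypercube are HOL functions of type \<open>(nat \<Rightarrow> real) \<Rightarrow> real\<close>; only their
  values on \<^const>\<open>hypercube\<close> enter the definitions below.\<close>

definition fourier_coeff :: "nat \<Rightarrow> ((nat \<Rightarrow> real) \<Rightarrow> real) \<Rightarrow> nat set \<Rightarrow> real" where
  "fourier_coeff n \<phi> S = (\<Sum>x\<in>hypercube n. \<phi> x * (\<Prod>i\<in>S. x i)) / 2 ^ n"

definition fourier_norm :: "nat \<Rightarrow> ((nat \<Rightarrow> real) \<Rightarrow> real) \<Rightarrow> real" where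
  "fourier_norm n \<phi> = (\<Sum>S\<in>Pow {1..n}. \<bar>fourier_coeff n \<phi> S\<bar>)"

definition subsets_of_size :: "nat set \<Rightarrow> nat \<Rightarrow> nat set set" where
  "subsets_of_size I j = {A. A \<subseteq> I \<and> card A = j \<and> finite A}"

definition fourier_level :: "nat \<Rightarrow> nat \<Rightarrow> ((nat \<Rightarrow> real) \<Rightarrow> real) \<Rightarrow> (nat \<Rightarrow> real) \<Rightarrow> real" where
  "fourier_level n k \<phi> x =
     (\<Sum>S\<in>subsets_of_size {1..n} k. fourier_coeff n \<phi> S * (\<Prod>i\<in>S. x i))"

text \<open>A real multilinear polynomial in \<open>x\<^sub>1, \<dots>, x\<^sub>n\<close> is encoded by its coefficients: \<open>c S\<close> is the
  coefficient of \<open>\<Prod>i\<in>S. x\<^sub>i\<close>.\<close>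

type_synonym mlpoly = "nat set \<Rightarrow> real"

definition is_mlpoly :: "nat \<Rightarrow> mlpoly \<Rightarrow> bool" where
  "is_mlpoly n c \<longleftrightarrow> (\<forall>S. c S \<noteq> 0 \<longrightarrow> S \<subseteq> {1..n})"

definition mlpoly_const :: "real \<Rightarrow> mlpoly" where
  "mlpoly_const a = (\<lambda>S. if S = {} then a else 0)"

definition mlpoly_eval :: "nat \<Rightarrow> mlpoly \<Rightarrow> (nat \<Rightarrow> real) \<Rightarrow> real" where
  "mlpoly_eval n c x = (\<Sum>S\<in>Pow {1..n}. c S * (\<Prod>i\<in>S. x i))"

definition mlpoly_involves :: "mlpoly \<Rightarrow> nat \<Rightarrow> bool" where
  "mlpoly_involves c i \<longleftrightarrow> (\<exists>S. c S \<noteq> 0 \<and> i \<in> S)"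

definition sign_strings :: "nat \<Rightarrow> real list set" where
  "sign_strings l = {v. length v = l \<and> set v \<subseteq> {-1, 1}}"

text \<open>A tree labels inner nodes by variable indices and leaves by polynomials, so the function \<open>T\<close>
  on strings is split into two fields: for a tree of depth \<open>d\<close>, \<open>query\<close> matters on strings of
  length less than \<open>d\<close> and \<open>leaf\<close> on strings of length \<open>d\<close>. The node \<open>v\<^sub>1 \<cdots> v\<^sub>i\<close> is \<open>take i v\<close>,
  and the entry \<open>v\<^sub>i\<close> is \<open>v ! (i - 1)\<close>.\<close>

record dtree =
  query :: "real list \<Rightarrow> nat"
  leaf :: "real list \<Rightarrow> mlpoly"

definition decision_tree :: "nat \<Rightarrow> nat \<Rightarrow> dtree \<Rightarrow> bool" where
  "decision_tree n d T \<longleftrightarrow>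
     (\<forall>l<d. \<forall>v\<in>sign_strings l. query T v \<in> {1..n}) \<and>
     (\<forall>v\<in>sign_strings (d - 1). inj_on (\<lambda>i. query T (take i v)) {..<d}) \<and>
     (\<forall>v\<in>sign_strings d. is_mlpoly n (leaf T v) \<and>
        (\<forall>i<d. \<not> mlpoly_involves (leaf T v) (query T (take i v))))"

definition tree_density :: "nat \<Rightarrow> dtree \<Rightarrow> real" where
  "tree_density d T =
     real (card {v \<in> sign_strings d. leaf T v \<noteq> mlpoly_const 0}) / real (card (sign_strings d))"

definition trees_star_0 :: "nat \<Rightarrow> nat \<Rightarrow> real \<Rightarrow> dtree set" where
  "trees_star_0 n d p = {T. decision_tree n d T \<and> tree_density d T = p \<and>
     (\<forall>v\<in>sign_strings d. leaf T v \<in> mlpoly_const ` {-1, 0, 1})}"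

definition tree_restrict ::
    "nat \<Rightarrow> nat \<Rightarrow> dtree \<Rightarrow> nat set set \<Rightarrow> (nat \<Rightarrow> real) \<Rightarrow> real" where
  "tree_restrict n d T \<S> x =
     (\<Sum>S\<in>\<S>. \<Sum>v\<in>sign_strings d. mlpoly_eval n (leaf T v) x * (1 / 2 ^ d) *
        (\<Prod>i\<in>S. v ! (i - 1) * x (query T (take (i - 1) v))))"

text \<open>Computability is meant for trees with constant leaves: with arbitrary polynomials at the
  leaves, a tree of any depth \<open>d \<le> n\<close> could compute every function.\<close>

definition dtree_computable :: "nat \<Rightarrow> nat \<Rightarrow> ((nat \<Rightarrow> real) \<Rightarrow> real) \<Rightarrow> bool" where
  "dtree_computable n d g \<longleftrightarrow>
     (\<exists>T. decision_tree n d T \<and> (\<forall>v\<in>sign_strings d. leaf T v \<in> range mlpoly_const) \<and>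
        (\<forall>x\<in>hypercube n. \<forall>v\<in>sign_strings d. (\<forall>i<d. v ! i = x (query T (take i v))) \<longrightarrow>
           g x = mlpoly_eval n (leaf T v) x))"

definition prob_nonzero :: "nat \<Rightarrow> ((nat \<Rightarrow> real) \<Rightarrow> real) \<Rightarrow> real" where
  "prob_nonzero n g = real (card {x \<in> hypercube n. g x \<noteq> 0}) / real (card (hypercube n))"

definition is_interval_nat :: "nat set \<Rightarrow> bool" where
  "is_interval_nat I \<longleftrightarrow> (\<exists>a b. I = {a..b})"

definition family_join :: "nat set set \<Rightarrow> nat set set \<Rightarrow> nat set set" where
  "family_join \<A> \<B> = {A \<union> B | A B. A \<in> \<A> \<and> B \<in> \<B>}"

text \<open>The fold starts from \<open>{{}}\<close>, the neutral element of \<^const>\<open>family_join\<close>.\<close>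

definition elementary_family :: "nat set set \<Rightarrow> bool" where
  "elementary_family \<E> \<longleftrightarrow>
     (\<exists>(l::nat) (I :: nat \<Rightarrow> nat set) (k :: nat \<Rightarrow> nat). l \<ge> 1 \<and>
        (\<forall>j\<in>{1..l}. is_interval_nat (I j) \<and> k j \<in> {0, 1, 2}) \<and>
        disjoint_family_on I {1..l} \<and>
        \<E> = foldr family_join (map (\<lambda>j. subsets_of_size (I j) (k j)) [1..<l + 1]) {{}})"

definition Lambda :: "nat \<Rightarrow> nat \<Rightarrow> real \<Rightarrow> real" where
  "Lambda m k p =
     (if p = 0 then 0
      else if p \<le> 1 / real m then
        p * sqrt ((1 / real k * ln (exp 1 ^ k * real m ^ (k - 1) / p)) ^ k)
      else p * sqrt (ln (exp 1 / p) * ln (exp 1 * real m) ^ (k - 1)))"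

end

theory Submission imports Defs begin

text \<open>The blocks of the elementary family are removed from the bottom of the tree upwards. If the last
  block starts below level \<open>a\<close>, every node \<open>u\<close> at level \<open>a\<close> carries the polynomial contributed by its
  subtree, whose norm is controlled by the level-one or level-two estimate at the density \<open>a u\<close> of
  that subtree. Expanding these polynomials into at most \<open>n\<^sup>2\<close> monomials leaves, for each monomial, a
  tree of depth \<open>a\<close> with real labels, and the norm of the remaining blocks is a seminorm in the
  labels. A labelling bounded by \<open>M\<close> is \<open>M\<close> times an average of labellings by \<open>-1, 0, 1\<close>, so
  concavity turns the induction hypothesis into a bound for real labels.

  Applied to all leaves at once this would lose a factor depending on \<open>k\<close>. Instead the leaves are
  grouped by dyadic scales of \<open>X = ln (e / a u)\<close>. Writing the claim as \<open>p \<surd>(B M\<^sup>k\<^sup>-\<^sup>1)\<close> with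
  \<open>B + (k - 1) M = ln (e / p) + (k - 1) ln (e n\<^sup>2)\<close>, the scale \<open>X \<approx> y B\<close> contributes at most
  \<open>\<surd>y exp ((1 - y) / 2)\<close> times the claim (\<open>y\<close> in place of \<open>\<surd>y\<close> for blocks of size two), which
  is summable over \<open>y = 1, 2, 4, \<dots>\<close>.\<close>

section \<open>Fourier analysis on the hypercube\<close>

text \<open>Losses stay free of k because of one inequality:
  \<open>A + t / k \<le> A * exp (t / (k * A))\<close> becomes a factor exp (t / A) after taking the
  k-th power. Whatever a block adds to k times the base of the power in \<open>Lambda\<close> is
  therefore paid once, not k times. Rounding needs a concave bound, so \<open>Lambda\<close> is
  exchanged for the possibly larger \<open>Lambda_env\<close>. After a density u is spread over m =
  n^2 monomials, the envelope is evaluated only at u / m \<le> 1 / m, where the two functions agree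
  and the terms ln m cancel. The first parameter is n^2 because a block of size j \<le> 2 yields at
  most n choose j \<le> n^2 monomials.\<close>

lemma finite_hypercube [simp]: "finite (hypercube n)"
  unfolding hypercube_def by (intro finite_PiE) auto

lemma card_hypercube: "card (hypercube n) = 2 ^ n"
  unfolding hypercube_def by (subst card_PiE) (auto simp: numeral_2_eq_2)

lemma hypercube_cases: "x \<in> hypercube n \<Longrightarrow> i \<in> {1..n} \<Longrightarrow> x i = -1 \<or> x i = 1"
  unfolding hypercube_def by (auto dest!: PiE_mem)

lemma hypercube_square: "x \<in> hypercube n \<Longrightarrow> i \<in> {1..n} \<Longrightarrow> x i * x i = 1"
  by (drule (1) hypercube_cases) auto

lemma sum_hypercube_prod:
  fixes h :: "nat \<Rightarrow> real \<Rightarrow> real"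
  shows "(\<Sum>x\<in>hypercube n. \<Prod>i\<in>{1..n}. h i (x i)) = (\<Prod>i\<in>{1..n}. h i (-1) + h i 1)"
proof -
  have "(\<Prod>i\<in>{1..n}. \<Sum>y\<in>{-1,1}. h i y) = (\<Sum>x\<in>hypercube n. \<Prod>i\<in>{1..n}. h i (x i))"
    unfolding hypercube_def by (rule prod_sum_PiE) auto
  then show ?thesis by simp
qed

lemma character_orthogonal:
  assumes "U \<subseteq> {1..n}" "W \<subseteq> {1..n}"
  shows "(\<Sum>x\<in>hypercube n. (\<Prod>i\<in>U. x i) * (\<Prod>i\<in>W. x i)) = (if U = W then 2 ^ n else 0 :: real)"
proof -
  let ?h = "\<lambda>i t::real. (if i \<in> U then t else 1) * (if i \<in> W then t else 1)"
  have *: "(\<Prod>i\<in>A. x i) = (\<Prod>i\<in>{1..n}. if i \<in> A then x i else 1)"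
    if "A \<subseteq> {1..n}" for A and x :: "nat \<Rightarrow> real"
    using that by (simp add: prod.If_cases Int_absorb1)
  have "(\<Sum>x\<in>hypercube n. (\<Prod>i\<in>U. x i) * (\<Prod>i\<in>W. x i))
      = (\<Sum>x\<in>hypercube n. \<Prod>i\<in>{1..n}. ?h i (x i))"
    by (simp only: *[OF assms(1)] *[OF assms(2)] prod.distrib)
  also have "\<dots> = (\<Prod>i\<in>{1..n}. ?h i (-1) + ?h i 1)"
    by (rule sum_hypercube_prod)
  also have "\<dots> = (if U = W then 2 ^ n else 0)"
  proof (cases "U = W")
    case True
    have "(\<Prod>i\<in>{1..n}. ?h i (-1) + ?h i 1) = (\<Prod>i\<in>{1..n}. 2)"
      using True by (intro prod.cong) auto
    then show ?thesis using True by simp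
  next
    case False
    then obtain i where "i \<in> {1..n}" "i \<in> U \<longleftrightarrow> i \<notin> W" using assms by blast
    then have "\<exists>i\<in>{1..n}. ?h i (-1) + ?h i 1 = 0" by (intro bexI[of _ i]) auto
    then have "(\<Prod>i\<in>{1..n}. ?h i (-1) + ?h i 1) = 0" by (intro prod_zero) auto
    then show ?thesis using False by simp
  qed
  finally show ?thesis .
qed

lemma prod_one_plus:
  fixes f :: "'a \<Rightarrow> 'b::comm_ring_1"
  assumes "finite A"
  shows "(\<Prod>i\<in>A. 1 + f i) = (\<Sum>B\<in>Pow A. \<Prod>i\<in>B. f i)"
  using prod_add[OF assms, of f "\<lambda>_. 1"] by (simp add: add.commute)

text \<open>Summed over all characters, the kernel is the product of the factors
  \<open>1 + y i * x i\<close>. It equals 2^n at y = x, and otherwise one factor vanishes.\<close>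

lemma fourier_inversion:
  assumes "x \<in> hypercube n"
  shows "\<phi> x = (\<Sum>U\<in>Pow {1..n}. fourier_coeff n \<phi> U * (\<Prod>i\<in>U. x i))"
proof -
  have kernel: "(\<Sum>U\<in>Pow {1..n}. (\<Prod>i\<in>U. y i * x i)) = (if y = x then 2 ^ n else 0)"
    if "y \<in> hypercube n" for y
  proof -
    have "(\<Sum>U\<in>Pow {1..n}. (\<Prod>i\<in>U. y i * x i)) = (\<Prod>i\<in>{1..n}. 1 + y i * x i)"
      by (subst prod_one_plus) auto
    also have "\<dots> = (if y = x then 2 ^ n else 0)"
    proof (cases "y = x")
      case True
      then have "(\<Prod>i\<in>{1..n}. 1 + y i * x i) = (\<Prod>i\<in>{1..n}. 2)"
        using hypercube_square[OF assms] by (intro prod.cong) auto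
      then show ?thesis using True by simp
    next
      case False
      have "\<exists>i\<in>{1..n}. y i \<noteq> x i"
        using False PiE_ext[of y "{1..n}" "\<lambda>_. {-1,1}" x] that assms unfolding hypercube_def by blast
      then obtain i where i: "i \<in> {1..n}" "y i \<noteq> x i" by blast
      then have "1 + y i * x i = 0"
        using hypercube_cases[OF assms i(1)] hypercube_cases[OF that i(1)] by auto
      then show ?thesis using False i(1) by (auto intro!: prod_zero)
    qed
    finally show ?thesis .
  qed
  have "(\<Sum>U\<in>Pow {1..n}. fourier_coeff n \<phi> U * (\<Prod>i\<in>U. x i))
      = (\<Sum>U\<in>Pow {1..n}. \<Sum>y\<in>hypercube n. \<phi> y / 2 ^ n * (\<Prod>i\<in>U. y i * x i))"
    by (simp add: fourier_coeff_def sum_divide_distrib sum_distrib_left sum_distrib_right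
        prod.distrib field_simps)
  also have "\<dots> = (\<Sum>y\<in>hypercube n. \<phi> y / 2 ^ n * (\<Sum>U\<in>Pow {1..n}. (\<Prod>i\<in>U. y i * x i)))"
    by (subst sum.swap) (simp add: sum_distrib_left)
  also have "\<dots> = (\<Sum>y\<in>hypercube n. if y = x then \<phi> x else 0)"
    by (intro sum.cong refl, simp only: kernel) simp
  also have "\<dots> = \<phi> x" using assms by simp
  finally show ?thesis by simp
qed

section \<open>Linearity of Fourier coefficients and inequalities for the norm\<close>

lemma fourier_coeff_cong:
  "(\<And>x. x \<in> hypercube n \<Longrightarrow> \<phi> x = \<psi> x) \<Longrightarrow> fourier_coeff n \<phi> U = fourier_coeff n \<psi> U"
  unfolding fourier_coeff_def by (simp cong: sum.cong)

lemma fourier_norm_cong: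
  "(\<And>x. x \<in> hypercube n \<Longrightarrow> \<phi> x = \<psi> x) \<Longrightarrow> fourier_norm n \<phi> = fourier_norm n \<psi>"
  unfolding fourier_norm_def using fourier_coeff_cong[of n \<phi> \<psi>] by simp

lemma fourier_coeff_sum:
  "fourier_coeff n (\<lambda>x. \<Sum>a\<in>A. \<phi> a x) U = (\<Sum>a\<in>A. fourier_coeff n (\<phi> a) U)"
proof -
  have "(\<Sum>x\<in>hypercube n. (\<Sum>a\<in>A. \<phi> a x) * (\<Prod>i\<in>U. x i))
      = (\<Sum>a\<in>A. \<Sum>x\<in>hypercube n. \<phi> a x * (\<Prod>i\<in>U. x i))"
    by (subst sum.swap) (simp add: sum_distrib_right)
  then show ?thesis by (simp add: fourier_coeff_def sum_divide_distrib)
qed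

lemma fourier_coeff_cmult:
  "fourier_coeff n (\<lambda>x. c * \<phi> x) U = c * fourier_coeff n \<phi> U"
  by (simp add: fourier_coeff_def sum_distrib_left mult_ac)

lemma fourier_coeff_character:
  assumes "U \<subseteq> {1..n}" "W \<subseteq> {1..n}"
  shows "fourier_coeff n (\<lambda>x. \<Prod>i\<in>W. x i) U = (if U = W then 1 else 0)"
  unfolding fourier_coeff_def by (subst character_orthogonal) (use assms in auto)

lemma fourier_norm_sum_le:
  "fourier_norm n (\<lambda>x. \<Sum>a\<in>A. \<phi> a x) \<le> (\<Sum>a\<in>A. fourier_norm n (\<phi> a))"
proof -
  have "(\<Sum>U\<in>Pow {1..n}. \<bar>fourier_coeff n (\<lambda>x. \<Sum>a\<in>A. \<phi> a x) U\<bar>)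
      \<le> (\<Sum>U\<in>Pow {1..n}. \<Sum>a\<in>A. \<bar>fourier_coeff n (\<phi> a) U\<bar>)"
    by (intro sum_mono) (simp add: fourier_coeff_sum sum_abs)
  then show ?thesis unfolding fourier_norm_def by (subst sum.swap) simp
qed

lemma fourier_norm_cmult: "fourier_norm n (\<lambda>x. c * \<phi> x) = \<bar>c\<bar> * fourier_norm n \<phi>"
  by (simp add: fourier_norm_def fourier_coeff_cmult abs_mult sum_distrib_left)

lemma fourier_norm_add_le:
  "fourier_norm n (\<lambda>x. \<phi> x + \<psi> x) \<le> fourier_norm n \<phi> + fourier_norm n \<psi>"
  using fourier_norm_sum_le[of n "\<lambda>b. if b then \<phi> else \<psi>" UNIV]
  by (simp add: UNIV_bool add.commute)

lemma fourier_norm_character: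
  assumes "W \<subseteq> {1..n}"
  shows "fourier_norm n (\<lambda>x. \<Prod>i\<in>W. x i) = 1"
proof -
  have "fourier_norm n (\<lambda>x. \<Prod>i\<in>W. x i) = (\<Sum>U\<in>Pow {1..n}. if U = W then 1 else 0)"
    unfolding fourier_norm_def
    by (intro sum.cong refl) (use assms in \<open>auto simp: fourier_coeff_character\<close>)
  then show ?thesis using assms by simp
qed

lemma character_mult:
  assumes "x \<in> hypercube n" "U \<subseteq> {1..n}" "W \<subseteq> {1..n}"
  shows "(\<Prod>i\<in>U. x i) * (\<Prod>i\<in>W. x i) = (\<Prod>i\<in>(U - W) \<union> (W - U). x i)"
proof -
  have fin: "finite U" "finite W" using assms finite_subset by blast+
  have U: "(\<Prod>i\<in>U. x i) = (\<Prod>i\<in>U - W. x i) * (\<Prod>i\<in>U \<inter> W. x i)"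
    by (subst prod.union_disjoint[symmetric]) (use fin in \<open>auto intro!: prod.cong\<close>)
  have W: "(\<Prod>i\<in>W. x i) = (\<Prod>i\<in>W - U. x i) * (\<Prod>i\<in>U \<inter> W. x i)"
    by (subst prod.union_disjoint[symmetric]) (use fin in \<open>auto intro!: prod.cong\<close>)
  have "(\<Prod>i\<in>U \<inter> W. x i) * (\<Prod>i\<in>U \<inter> W. x i) = (\<Prod>i\<in>U \<inter> W. x i * x i)"
    by (simp add: prod.distrib)
  also have "\<dots> = 1"
    using assms by (intro prod.neutral) (auto intro!: hypercube_square)
  finally have "(\<Prod>i\<in>U \<inter> W. x i) * (\<Prod>i\<in>U \<inter> W. x i) = 1" .
  then have "(\<Prod>i\<in>U. x i) * (\<Prod>i\<in>W. x i) = (\<Prod>i\<in>U - W. x i) * (\<Prod>i\<in>W - U. x i)"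
    unfolding U W by (metis (no_types, lifting) mult.assoc mult.left_commute mult.right_neutral)
  then show ?thesis
    by (subst prod.union_disjoint) (use fin in auto)
qed

text \<open>Multiplication by a character permutes the characters by symmetric difference with U.
  Monomials produced by a lower block can thus be dropped even if their variables were to overlap
  with those queried above.\<close>

lemma fourier_norm_character_mult_le:
  assumes "U \<subseteq> {1..n}"
  shows "fourier_norm n (\<lambda>x. (\<Prod>i\<in>U. x i) * \<phi> x) \<le> fourier_norm n \<phi>"
proof -
  have "fourier_norm n (\<lambda>x. (\<Prod>i\<in>U. x i) * \<phi> x)
      = fourier_norm n (\<lambda>x. \<Sum>W\<in>Pow {1..n}. fourier_coeff n \<phi> W * (\<Prod>i\<in>(U - W) \<union> (W - U). x i))"
  proof (rule fourier_norm_cong)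
    fix x assume x: "x \<in> hypercube n"
    have "(\<Prod>i\<in>U. x i) * \<phi> x
        = (\<Sum>W\<in>Pow {1..n}. fourier_coeff n \<phi> W * ((\<Prod>i\<in>U. x i) * (\<Prod>i\<in>W. x i)))"
      by (subst fourier_inversion[OF x, of \<phi>]) (simp add: sum_distrib_left mult_ac)
    also have "\<dots> = (\<Sum>W\<in>Pow {1..n}. fourier_coeff n \<phi> W * (\<Prod>i\<in>(U - W) \<union> (W - U). x i))"
      by (intro sum.cong refl) (use character_mult[OF x assms] in simp)
    finally show "(\<Prod>i\<in>U. x i) * \<phi> x
        = (\<Sum>W\<in>Pow {1..n}. fourier_coeff n \<phi> W * (\<Prod>i\<in>(U - W) \<union> (W - U). x i))" .
  qed
  also have "\<dots> \<le> (\<Sum>W\<in>Pow {1..n}. \<bar>fourier_coeff n \<phi> W\<bar>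
      * fourier_norm n (\<lambda>x. \<Prod>i\<in>(U - W) \<union> (W - U). x i))"
    by (rule order_trans[OF fourier_norm_sum_le]) (simp add: fourier_norm_cmult)
  also have "\<dots> = (\<Sum>W\<in>Pow {1..n}. \<bar>fourier_coeff n \<phi> W\<bar>)"
  proof (rule sum.cong[OF refl])
    fix W assume "W \<in> Pow {1..n}"
    then have "(U - W) \<union> (W - U) \<subseteq> {1..n}" using assms by blast
    then show "\<bar>fourier_coeff n \<phi> W\<bar> * fourier_norm n (\<lambda>x. \<Prod>i\<in>(U - W) \<union> (W - U). x i)
        = \<bar>fourier_coeff n \<phi> W\<bar>"
      by (simp add: fourier_norm_character)
  qed
  finally show ?thesis by (simp add: fourier_norm_def)
qed

lemma finite_subsets_of_size [simp]: "finite I \<Longrightarrow> finite (subsets_of_size I j)"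
  unfolding subsets_of_size_def by (rule finite_subset[of _ "Pow I"]) auto

lemma card_subsets_of_size:
  assumes "finite I"
  shows "card (subsets_of_size I j) = card I choose j"
proof -
  have "subsets_of_size I j = {A. A \<subseteq> I \<and> card A = j}"
    using assms finite_subset by (auto simp: subsets_of_size_def)
  then show ?thesis using n_subsets[OF assms] by simp
qed

section \<open>Sign strings and decision trees\<close>

lemma sign_strings_conv: "sign_strings l = {v. set v \<subseteq> {-1, 1} \<and> length v = l}"
  by (auto simp: sign_strings_def)

lemma finite_sign_strings [simp]: "finite (sign_strings l)"
  unfolding sign_strings_conv by (rule finite_lists_length_eq) simp

lemma card_sign_strings: "card (sign_strings l) = 2 ^ l"
  unfolding sign_strings_conv by (subst card_lists_length_eq) (auto simp: numeral_2_eq_2)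

lemma sign_strings_0 [simp]: "sign_strings 0 = {[]}"
  by (auto simp: sign_strings_def)

lemma length_sign_strings: "v \<in> sign_strings l \<Longrightarrow> length v = l"
  by (simp add: sign_strings_def)

lemma append_sign_strings:
  "u \<in> sign_strings a \<Longrightarrow> w \<in> sign_strings e \<Longrightarrow> u @ w \<in> sign_strings (a + e)"
  by (auto simp: sign_strings_def)

lemma take_sign_strings: "v \<in> sign_strings l \<Longrightarrow> i \<le> l \<Longrightarrow> take i v \<in> sign_strings i"
  using set_take_subset[of i v] by (auto simp: sign_strings_def)

lemma nth_sign_strings: "v \<in> sign_strings l \<Longrightarrow> i < l \<Longrightarrow> v ! i = -1 \<or> v ! i = 1"
  using nth_mem[of i v] unfolding sign_strings_def by blast

lemma replicate_sign_strings: "replicate l 1 \<in> sign_strings l"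
  by (auto simp: sign_strings_def)

lemma sum_sign_strings_append:
  fixes F :: "real list \<Rightarrow> 'b::comm_monoid_add"
  shows "(\<Sum>v\<in>sign_strings (a + e). F v)
    = (\<Sum>u\<in>sign_strings a. \<Sum>w\<in>sign_strings e. F (u @ w))"
proof -
  have "(\<Sum>v\<in>sign_strings (a + e). F v)
      = (\<Sum>(u, w)\<in>sign_strings a \<times> sign_strings e. F (u @ w))"
  proof (rule sum.reindex_bij_witness[of _ "\<lambda>(u, w). u @ w" "\<lambda>v. (take a v, drop a v)"])
    fix v assume "v \<in> sign_strings (a + e)"
    then show "(take a v, drop a v) \<in> sign_strings a \<times> sign_strings e"
      using set_take_subset[of a v] set_drop_subset[of a v] by (auto simp: sign_strings_def)
  qed (auto simp: append_sign_strings length_sign_strings)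
  then show ?thesis by (simp add: sum.cartesian_product)
qed

text \<open>Applied to \<bar>f\<bar>, this is the density of a labelling by -1, 0, 1, and the
  substitute for the density when labels are real.\<close>

definition avg :: "nat \<Rightarrow> (real list \<Rightarrow> real) \<Rightarrow> real" where
  "avg d f = (\<Sum>v\<in>sign_strings d. f v) / 2 ^ d"

lemma avg_append: "avg (a + e) f = avg a (\<lambda>u. avg e (\<lambda>w. f (u @ w)))"
  by (simp add: avg_def sum_sign_strings_append sum_divide_distrib power_add mult.commute)

lemma avg_mono: "(\<And>v. v \<in> sign_strings d \<Longrightarrow> f v \<le> g v) \<Longrightarrow> avg d f \<le> avg d g"
  unfolding avg_def by (intro divide_right_mono sum_mono) auto

lemma avg_const [simp]: "avg d (\<lambda>_. c) = c"
  by (simp add: avg_def card_sign_strings)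

lemma avg_cmult: "avg d (\<lambda>v. c * f v) = c * avg d f"
  by (simp add: avg_def sum_distrib_left)

lemma avg_add: "avg d (\<lambda>v. f v + g v) = avg d f + avg d g"
  by (simp add: avg_def sum.distrib add_divide_distrib)

lemma avg_sum: "avg d (\<lambda>v. \<Sum>a\<in>A. f a v) = (\<Sum>a\<in>A. avg d (f a))"
  unfolding avg_def by (subst sum.swap) (simp add: sum_divide_distrib)

lemma avg_cong: "(\<And>v. v \<in> sign_strings d \<Longrightarrow> f v = g v) \<Longrightarrow> avg d f = avg d g"
  unfolding avg_def by (simp cong: sum.cong)

lemma avg_nonneg: "(\<And>v. v \<in> sign_strings d \<Longrightarrow> 0 \<le> f v) \<Longrightarrow> 0 \<le> avg d f"
  unfolding avg_def by (simp add: sum_nonneg)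

lemma avg_eq_0D:
  assumes "avg d f = 0" "\<And>v. v \<in> sign_strings d \<Longrightarrow> 0 \<le> f v" "v \<in> sign_strings d"
  shows "f v = 0"
proof -
  have "(\<Sum>v\<in>sign_strings d. f v) = 0" using assms(1) by (simp add: avg_def)
  then show ?thesis
    using sum_nonneg_eq_0_iff[of "sign_strings d" f, OF finite_sign_strings assms(2)] assms(3) by blast
qed

text \<open>The part of \<open>decision_tree\<close> that concerns the queries alone. The proof
  keeps the queries of a tree and varies its labels, so the two are separated.\<close>

definition query_wf :: "nat \<Rightarrow> nat \<Rightarrow> (real list \<Rightarrow> nat) \<Rightarrow> bool" where
  "query_wf n d q \<longleftrightarrow> (\<forall>l<d. \<forall>v\<in>sign_strings l. q v \<in> {1..n}) \<and>
     (\<forall>v\<in>sign_strings (d - 1). inj_on (\<lambda>i. q (take i v)) {..<d})"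

lemma query_wf_query: "query_wf n d q \<Longrightarrow> l < d \<Longrightarrow> v \<in> sign_strings l \<Longrightarrow> q v \<in> {1..n}"
  unfolding query_wf_def by blast

lemma query_wf_range:
  assumes "query_wf n d q" "v \<in> sign_strings d" "i < d"
  shows "q (take i v) \<in> {1..n}"
  using query_wf_query[OF assms(1,3) take_sign_strings[OF assms(2)]] assms(3) by simp

lemma query_wf_inj:
  assumes "query_wf n d q" "v \<in> sign_strings d"
  shows "inj_on (\<lambda>i. q (take i v)) {..<d}"
proof -
  have "take (d - 1) v \<in> sign_strings (d - 1)" using assms(2) by (rule take_sign_strings) simp
  then have "inj_on (\<lambda>i. q (take i (take (d - 1) v))) {..<d}"
    using assms(1) unfolding query_wf_def by blast
  moreover have "q (take i (take (d - 1) v)) = q (take i v)" if "i \<in> {..<d}" for i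
    using that by (simp add: min_absorb1)
  ultimately show ?thesis by (rule inj_on_cong[THEN iffD1, rotated])
qed

lemma query_wf_prefix:
  assumes "query_wf n d q" "a \<le> d"
  shows "query_wf n a q"
  unfolding query_wf_def
proof (intro conjI ballI allI impI)
  fix l v assume "l < a" "v \<in> sign_strings l"
  then show "q v \<in> {1..n}" using assms by (intro query_wf_query[OF assms(1)]) auto
next
  fix v assume v: "v \<in> sign_strings (a - 1)"
  \<comment> \<open>An arbitrary extension to full length; the prefixes of length less than a do not
    see it.\<close>
  let ?w = "v @ replicate (d - (a - 1)) 1"
  have "?w \<in> sign_strings (a - 1 + (d - (a - 1)))"
    using v replicate_sign_strings by (rule append_sign_strings)
  then have "?w \<in> sign_strings d" using assms(2) by simp
  then have "inj_on (\<lambda>i. q (take i ?w)) {..<d}" by (rule query_wf_inj[OF assms(1)])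
  then have "inj_on (\<lambda>i. q (take i ?w)) {..<a}" by (rule inj_on_subset) (use assms(2) in auto)
  moreover have "q (take i ?w) = q (take i v)" if "i \<in> {..<a}" for i
    using that length_sign_strings[OF v] by simp
  ultimately show "inj_on (\<lambda>i. q (take i v)) {..<a}"
    by (rule inj_on_cong[THEN iffD1, rotated])
qed

lemma query_wf_subtree:
  assumes "query_wf n (a + e) q" "u \<in> sign_strings a"
  shows "query_wf n e (\<lambda>w. q (u @ w))"
  unfolding query_wf_def
proof (intro conjI ballI allI impI)
  fix l w assume "l < e" "w \<in> sign_strings l"
  then show "q (u @ w) \<in> {1..n}"
    using assms append_sign_strings[OF assms(2), of w l]
    by (intro query_wf_query[OF assms(1), of "a + l"]) auto
next
  fix w assume w: "w \<in> sign_strings (e - 1)"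
  show "inj_on (\<lambda>i. q (u @ take i w)) {..<e}"
  proof (cases "e = 0")
    case False
    have "u @ w \<in> sign_strings (a + e - 1)"
      using append_sign_strings[OF assms(2) w] False by simp
    then have inj: "inj_on (\<lambda>i. q (take i (u @ w))) {..<a + e}"
      using assms(1) unfolding query_wf_def by blast
    have "inj_on (\<lambda>i. q (take (a + i) (u @ w))) {..<e}"
    proof -
      have "(+) a ` {..<e} \<subseteq> {..<a + e}" by auto
      from comp_inj_on[OF _ inj_on_subset[OF inj this]] show ?thesis by (simp add: comp_def)
    qed
    then show ?thesis using length_sign_strings[OF assms(2)] by simp
  qed simp
qed

text \<open>\<open>tree_restrict\<close> for constant leaves, with the labels given by a real
  function. Labels outside -1, 0, 1 arise because Fourier coefficients of a removed block become
  labels of the truncated tree.\<close>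

definition tree_poly ::
    "(real list \<Rightarrow> nat) \<Rightarrow> nat \<Rightarrow> (real list \<Rightarrow> real) \<Rightarrow> nat set set \<Rightarrow> (nat \<Rightarrow> real) \<Rightarrow> real" where
  "tree_poly q d f \<E> x =
     (\<Sum>S\<in>\<E>. avg d (\<lambda>v. f v * (\<Prod>i\<in>S. v ! (i - 1) * x (q (take (i - 1) v)))))"

lemma tree_poly_singleton:
  "tree_poly q d f {S} x = avg d (\<lambda>v. f v * (\<Prod>i\<in>S. v ! (i - 1) * x (q (take (i - 1) v))))"
  by (simp add: tree_poly_def)

lemma tree_poly_split: "tree_poly q d f \<E> x = (\<Sum>S\<in>\<E>. tree_poly q d f {S} x)"
  by (simp add: tree_poly_def)

text \<open>Distinctness of the queries along a path enters here: no variable is repeated, so the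
  product over S is a sign times a character of size exactly \<open>card S\<close>.\<close>

lemma path_character:
  assumes "query_wf n d q" "v \<in> sign_strings d" "S \<subseteq> {1..d}"
  defines "W \<equiv> (\<lambda>i. q (take (i - 1) v)) ` S"
  shows "W \<subseteq> {1..n}" "card W = card S"
    "(\<Prod>i\<in>S. v ! (i - 1) * x (q (take (i - 1) v))) = (\<Prod>i\<in>S. v ! (i - 1)) * (\<Prod>i\<in>W. x i)"
proof -
  have inj: "inj_on (\<lambda>i. q (take (i - 1) v)) S"
  proof (rule inj_onI)
    fix i j assume *: "i \<in> S" "j \<in> S" "q (take (i - 1) v) = q (take (j - 1) v)"
    then have "1 \<le> i" "i \<le> d" "1 \<le> j" "j \<le> d" using assms(3) by auto
    moreover from this have "i - 1 = j - 1"
      using inj_onD[OF query_wf_inj[OF assms(1,2)] *(3)] by simp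
    ultimately show "i = j" by simp
  qed
  show "card W = card S" unfolding W_def using inj by (rule card_image)
  show "(\<Prod>i\<in>S. v ! (i - 1) * x (q (take (i - 1) v))) = (\<Prod>i\<in>S. v ! (i - 1)) * (\<Prod>i\<in>W. x i)"
    unfolding W_def by (simp only: prod.reindex[OF inj] prod.distrib comp_def)
  show "W \<subseteq> {1..n}"
  proof
    fix y assume "y \<in> W"
    then obtain i where "i \<in> S" "y = q (take (i - 1) v)" unfolding W_def by blast
    moreover from this have "1 \<le> i" "i \<le> d" using assms(3) by auto
    ultimately show "y \<in> {1..n}" using query_wf_range[OF assms(1,2), of "i - 1"] by auto
  qed
qed

lemma fourier_coeff_tree_poly_singleton_eq_0:
  assumes "query_wf n d q" "S \<subseteq> {1..d}" "U \<subseteq> {1..n}" "card U \<noteq> card S"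
  shows "fourier_coeff n (tree_poly q d f {S}) U = 0"
proof -
  have "fourier_coeff n (tree_poly q d f {S}) U
      = fourier_coeff n (\<lambda>x. \<Sum>v\<in>sign_strings d. (f v * (\<Prod>i\<in>S. v ! (i - 1)) / 2 ^ d)
          * (\<Prod>i\<in>(\<lambda>i. q (take (i - 1) v)) ` S. x i)) U"
    using path_character(3)[OF assms(1) _ assms(2)]
    by (intro fourier_coeff_cong) (simp add: tree_poly_singleton avg_def sum_divide_distrib mult.assoc)
  also have "\<dots> = 0"
    unfolding fourier_coeff_sum fourier_coeff_cmult
  proof (intro sum.neutral ballI)
    fix v assume v: "v \<in> sign_strings d"
    have "U \<noteq> (\<lambda>i. q (take (i - 1) v)) ` S"
      using path_character(2)[OF assms(1) v assms(2)] assms(4) by metis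
    then show "f v * (\<Prod>i\<in>S. v ! (i - 1)) / 2 ^ d
        * fourier_coeff n (\<lambda>x. \<Prod>i\<in>(\<lambda>i. q (take (i - 1) v)) ` S. x i) U = 0"
      by (simp only: fourier_coeff_character[OF assms(3) path_character(1)[OF assms(1) v assms(2)]]
          if_False mult_zero_right)
  qed
  finally show ?thesis .
qed

lemma fourier_coeff_tree_poly:
  "fourier_coeff n (tree_poly q d f \<E>) U = (\<Sum>S\<in>\<E>. fourier_coeff n (tree_poly q d f {S}) U)"
  unfolding fourier_coeff_sum[symmetric] by (intro fourier_coeff_cong tree_poly_split)

lemma fourier_coeff_tree_poly_eq_0:
  assumes "query_wf n d q" "\<E> \<subseteq> subsets_of_size {1..d} j" "U \<subseteq> {1..n}" "card U \<noteq> j"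
  shows "fourier_coeff n (tree_poly q d f \<E>) U = 0"
proof (subst fourier_coeff_tree_poly, intro sum.neutral ballI)
  fix S assume "S \<in> \<E>"
  then have "S \<subseteq> {1..d}" "card S = j" using assms(2) by (auto simp: subsets_of_size_def)
  then show "fourier_coeff n (tree_poly q d f {S}) U = 0"
    using fourier_coeff_tree_poly_singleton_eq_0[OF assms(1) _ assms(3)] assms(4) by metis
qed

text \<open>Summing over all families of levels recovers the function computed by the tree.\<close>

lemma tree_poly_Pow:
  "tree_poly q d f (Pow {1..d}) x
    = (\<Sum>v\<in>sign_strings d. f v * (\<Prod>i\<in>{1..d}. (1 + v ! (i - 1) * x (q (take (i - 1) v))) / 2))"
proof -
  have "(\<Prod>i\<in>{1..d}. (1 + v ! (i - 1) * x (q (take (i - 1) v))) / 2)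
      = (\<Sum>S\<in>Pow {1..d}. \<Prod>i\<in>S. v ! (i - 1) * x (q (take (i - 1) v))) / 2 ^ d" for v
    by (simp add: prod_dividef prod_one_plus)
  then show ?thesis
    unfolding tree_poly_def
    by (simp add: avg_sum[symmetric]) (simp add: avg_def sum_divide_distrib sum_distrib_left)
qed

section \<open>Paths and the function computed by a tree\<close>

lemma ex_path:
  assumes "x \<in> hypercube n" "query_wf n d q"
  shows "\<exists>v\<in>sign_strings d. \<forall>i<d. v ! i = x (q (take i v))"
  using assms(2)
proof (induction d)
  case (Suc d)
  then obtain v where v: "v \<in> sign_strings d" "\<forall>i<d. v ! i = x (q (take i v))"
    using query_wf_prefix[of n "Suc d" q d] by auto
  have "q v \<in> {1..n}" using Suc.prems v(1) unfolding query_wf_def by blast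
  then have "x (q v) = -1 \<or> x (q v) = 1" by (rule hypercube_cases[OF assms(1)])
  then have "v @ [x (q v)] \<in> sign_strings (d + 1)"
    by (intro append_sign_strings v(1)) (auto simp: sign_strings_def)
  then have "v @ [x (q v)] \<in> sign_strings (Suc d)" by simp
  moreover have "(v @ [x (q v)]) ! i = x (q (take i (v @ [x (q v)])))" if "i < Suc d" for i
    using that v length_sign_strings[OF v(1)] by (auto simp: nth_append less_Suc_eq)
  ultimately show ?case by blast
qed simp

lemma path_unique:
  assumes "v \<in> sign_strings d" "\<forall>i<d. v ! i = x (q (take i v))"
    and "w \<in> sign_strings d" "\<forall>i<d. w ! i = x (q (take i w))"
  shows "v = w"
proof -
  have len: "length v = d" "length w = d" using assms by (auto simp: length_sign_strings)
  have "take i v = take i w" if "i \<le> d" for i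
    using that
  proof (induction i)
    case (Suc i)
    then show ?case using assms(2,4) len by (simp add: take_Suc_conv_app_nth)
  qed simp
  from this[of d] len show ?thesis by simp
qed

text \<open>The product attached to a leaf w is the indicator that x follows the path to w: any
  entry of w that differs from the queried coordinate makes a factor vanish.\<close>

lemma tree_poly_Pow_eval:
  assumes "x \<in> hypercube n" "query_wf n d q"
    and v: "v \<in> sign_strings d" "\<forall>i<d. v ! i = x (q (take i v))"
  shows "tree_poly q d f (Pow {1..d}) x = f v"
proof -
  have "(\<Prod>i\<in>{1..d}. (1 + w ! (i - 1) * x (q (take (i - 1) w))) / 2) = (if w = v then 1 else 0)"
    if w: "w \<in> sign_strings d" for w
  proof (cases "w = v")
    case True
    have "(1 + v ! (i - 1) * x (q (take (i - 1) v))) / 2 = 1" if "i \<in> {1..d}" for i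
    proof -
      have "v ! (i - 1) = x (q (take (i - 1) v))" "v ! (i - 1) = -1 \<or> v ! (i - 1) = 1"
        using that v nth_sign_strings[OF v(1), of "i - 1"] by auto
      then show ?thesis by auto
    qed
    then show ?thesis using True by simp
  next
    case False
    then obtain i where i: "i < d" "w ! i \<noteq> x (q (take i w))"
      using path_unique[of v d x q w] v w by blast
    have "q (take i w) \<in> {1..n}" by (rule query_wf_range[OF assms(2) w i(1)])
    then have "1 + w ! i * x (q (take i w)) = 0"
      using hypercube_cases[OF assms(1)] nth_sign_strings[OF w i(1)] i(2) by fastforce
    then have "\<exists>i\<in>{1..d}. (1 + w ! (i - 1) * x (q (take (i - 1) w))) / 2 = 0"
      using i(1) by (intro bexI[of _ "Suc i"]) auto
    then show ?thesis using False by (simp add: prod_zero)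
  qed
  then have "tree_poly q d f (Pow {1..d}) x = (\<Sum>w\<in>sign_strings d. if w = v then f v else 0)"
    unfolding tree_poly_Pow by (intro sum.cong) auto
  then show ?thesis using v(1) by simp
qed

text \<open>Each set S of levels contributes only in degree \<open>card S\<close>, so the degree-j
  part collects exactly the j-subsets. This carries the hypotheses on \<open>fourier_level\<close>
  over to trees.\<close>

lemma fourier_level_tree_poly:
  assumes "query_wf n d q" "x \<in> hypercube n"
  shows "fourier_level n j (tree_poly q d f (Pow {1..d})) x
    = tree_poly q d f (subsets_of_size {1..d} j) x"
proof -
  let ?\<phi> = "tree_poly q d f (subsets_of_size {1..d} j)"
  let ?g = "tree_poly q d f (Pow {1..d})"
  have coeff: "fourier_coeff n ?\<phi> U = (if card U = j then fourier_coeff n ?g U else 0)"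
    if U: "U \<subseteq> {1..n}" for U
  proof (cases "card U = j")
    case True
    have "fourier_coeff n ?g U = (\<Sum>S\<in>Pow {1..d}. fourier_coeff n (tree_poly q d f {S}) U)"
      by (rule fourier_coeff_tree_poly)
    also have "\<dots> = (\<Sum>S\<in>subsets_of_size {1..d} j. fourier_coeff n (tree_poly q d f {S}) U)"
    proof (rule sum.mono_neutral_right)
      show "\<forall>S\<in>Pow {1..d} - subsets_of_size {1..d} j. fourier_coeff n (tree_poly q d f {S}) U = 0"
      proof
        fix S assume S: "S \<in> Pow {1..d} - subsets_of_size {1..d} j"
        then have "finite S" using finite_subset by blast
        then have "card U \<noteq> card S" using S True by (auto simp: subsets_of_size_def)
        then show "fourier_coeff n (tree_poly q d f {S}) U = 0"
          using S by (intro fourier_coeff_tree_poly_singleton_eq_0[OF assms(1) _ U]) auto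
      qed
    qed (auto simp: subsets_of_size_def)
    also have "\<dots> = fourier_coeff n ?\<phi> U"
      by (rule fourier_coeff_tree_poly[symmetric])
    finally show ?thesis using True by simp
  next
    case False
    then show ?thesis using fourier_coeff_tree_poly_eq_0[OF assms(1) order_refl U] by simp
  qed
  have "?\<phi> x = (\<Sum>U\<in>Pow {1..n}. fourier_coeff n ?\<phi> U * (\<Prod>i\<in>U. x i))"
    by (rule fourier_inversion[OF assms(2)])
  also have "\<dots> = (\<Sum>U\<in>Pow {1..n}.
      if card U = j then fourier_coeff n ?g U * (\<Prod>i\<in>U. x i) else 0)"
  proof (intro sum.cong refl)
    fix U assume "U \<in> Pow {1..n}"
    then show "fourier_coeff n ?\<phi> U * (\<Prod>i\<in>U. x i)
        = (if card U = j then fourier_coeff n ?g U * (\<Prod>i\<in>U. x i) else 0)"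
      by (subst coeff) auto
  qed
  also have "\<dots> = fourier_level n j ?g x"
    unfolding fourier_level_def
    by (intro sum.mono_neutral_cong_right) (auto simp: subsets_of_size_def intro: finite_subset)
  finally show ?thesis by simp
qed

text \<open>The tree with labels \<bar>f\<bar> computes the indicator of a nonzero value, so the
  probability is its constant Fourier coefficient, to which only the empty set of levels
  contributes.\<close>

lemma prob_nonzero_tree_poly:
  assumes "query_wf n d q" "\<And>v. v \<in> sign_strings d \<Longrightarrow> f v \<in> {-1, 0, 1}"
  shows "prob_nonzero n (tree_poly q d f (Pow {1..d})) = avg d (\<lambda>v. \<bar>f v\<bar>)"
proof -
  let ?g = "tree_poly q d f (Pow {1..d})"
  let ?h = "tree_poly q d (\<lambda>v. \<bar>f v\<bar>) (Pow {1..d})"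
  have h: "?h x = (if ?g x \<noteq> 0 then 1 else 0)" if x: "x \<in> hypercube n" for x
  proof -
    obtain v where v: "v \<in> sign_strings d" "\<forall>i<d. v ! i = x (q (take i v))"
      using ex_path[OF x assms(1)] by blast
    show ?thesis
      unfolding tree_poly_Pow_eval[OF x assms(1) v] using assms(2)[OF v(1)] by auto
  qed
  have "(\<Sum>x\<in>hypercube n. ?h x) = (\<Sum>x\<in>hypercube n. if ?g x \<noteq> 0 then 1 else 0)"
    by (intro sum.cong refl h)
  also have "\<dots> = real (card {x \<in> hypercube n. ?g x \<noteq> 0})"
    by (simp add: sum.If_cases Int_def)
  finally have "prob_nonzero n ?g = (\<Sum>x\<in>hypercube n. ?h x) / 2 ^ n"
    unfolding prob_nonzero_def by (simp add: card_hypercube)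
  also have "\<dots> = fourier_coeff n ?h {}"
    by (simp add: fourier_coeff_def)
  also have "\<dots> = (\<Sum>S\<in>Pow {1..d}. fourier_coeff n (tree_poly q d (\<lambda>v. \<bar>f v\<bar>) {S}) {})"
    by (rule fourier_coeff_tree_poly)
  also have "\<dots> = (\<Sum>S\<in>{{}}. fourier_coeff n (tree_poly q d (\<lambda>v. \<bar>f v\<bar>) {S}) {})"
  proof (rule sum.mono_neutral_right)
    show "\<forall>S\<in>Pow {1..d} - {{}}. fourier_coeff n (tree_poly q d (\<lambda>v. \<bar>f v\<bar>) {S}) {} = 0"
    proof
      fix S assume S: "S \<in> Pow {1..d} - {{}}"
      then have "finite S" using finite_subset by blast
      then have "card {} \<noteq> card S" using S by auto
      then show "fourier_coeff n (tree_poly q d (\<lambda>v. \<bar>f v\<bar>) {S}) {} = 0"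
        using S by (intro fourier_coeff_tree_poly_singleton_eq_0[OF assms(1)]) auto
    qed
  qed auto
  also have "\<dots> = avg d (\<lambda>v. \<bar>f v\<bar>)"
    by (simp add: tree_poly_singleton fourier_coeff_def card_hypercube)
  finally show ?thesis .
qed

lemma dtree_computable_tree_poly:
  assumes "query_wf n d q"
  shows "dtree_computable n d (tree_poly q d f (Pow {1..d}))"
proof -
  let ?T = "\<lparr>query = q, leaf = \<lambda>v. mlpoly_const (f v)\<rparr>"
  have "decision_tree n d ?T"
    using assms unfolding decision_tree_def query_wf_def
    by (auto simp: is_mlpoly_def mlpoly_involves_def mlpoly_const_def split: if_splits)
  moreover have "mlpoly_eval n (mlpoly_const c) x = c" for c x
    by (simp add: mlpoly_eval_def mlpoly_const_def if_distrib[of "\<lambda>c. c * _"] cong: if_cong)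
  ultimately show ?thesis
    unfolding dtree_computable_def using tree_poly_Pow_eval[OF _ assms]
    by (intro exI[of _ ?T]) auto
qed

section \<open>Concave envelopes\<close>

text \<open>A function is supported if at every point of the half-open unit interval it has a supporting
  line with nonnegative slope and intercept; this is the form in which concavity of
  \<open>x \<mapsto> x \<surd>(\<dots>)\<close> follows from \<open>1 + t \<le> exp t\<close> without any derivative.\<close>

definition supported :: "(real \<Rightarrow> real) \<Rightarrow> bool" where
  "supported h \<longleftrightarrow> (\<forall>p. 0 < p \<and> p \<le> 1 \<longrightarrow> (\<exists>s\<ge>0. \<exists>c\<ge>0. h p = s * p + c \<and>
     (\<forall>x. 0 \<le> x \<and> x \<le> 1 \<longrightarrow> h x \<le> s * x + c)))"

text \<open>Jensen's inequality with slack: as slope and intercept are nonnegative, upper bounds on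
  the number of terms and on their sum suffice.\<close>

lemma supported_sum_le:
  assumes "supported h" "finite A" "real (card A) \<le> m" "0 < p" "p \<le> 1"
    and x: "\<And>i. i \<in> A \<Longrightarrow> 0 \<le> x i \<and> x i \<le> 1" and sum: "(\<Sum>i\<in>A. x i) \<le> m * p"
  shows "(\<Sum>i\<in>A. h (x i)) \<le> m * h p"
proof -
  obtain s c where sc: "s \<ge> 0" "c \<ge> 0" "h p = s * p + c"
      "\<And>x. 0 \<le> x \<Longrightarrow> x \<le> 1 \<Longrightarrow> h x \<le> s * x + c"
    using assms(1,4,5) unfolding supported_def by meson
  have "(\<Sum>i\<in>A. h (x i)) \<le> (\<Sum>i\<in>A. s * x i + c)"
    using x sc(4) by (intro sum_mono) auto
  also have "\<dots> = s * (\<Sum>i\<in>A. x i) + real (card A) * c"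
    by (simp add: sum.distrib sum_distrib_left)
  also have "\<dots> \<le> s * (m * p) + m * c"
    using sum assms(3) sc(1,2) by (intro add_mono mult_left_mono mult_right_mono) auto
  also have "\<dots> = m * h p" by (simp add: sc(3) algebra_simps)
  finally show ?thesis .
qed

lemma supported_avg_le:
  assumes "supported h" "\<And>v. v \<in> sign_strings d \<Longrightarrow> 0 \<le> f v \<and> f v \<le> 1" "0 < avg d f"
  shows "avg d (\<lambda>v. h (f v)) \<le> h (avg d f)"
proof -
  have "avg d f \<le> avg d (\<lambda>_. 1)" using assms(2) by (intro avg_mono) auto
  then have le1: "avg d f \<le> 1" by simp
  have "(\<Sum>v\<in>sign_strings d. h (f v)) \<le> 2 ^ d * h (avg d f)"
  proof (rule supported_sum_le[OF assms(1) finite_sign_strings _ assms(3) le1])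
    show "real (card (sign_strings d)) \<le> 2 ^ d" by (simp add: card_sign_strings)
    show "(\<Sum>v\<in>sign_strings d. f v) \<le> 2 ^ d * avg d f" by (simp add: avg_def)
  qed (rule assms(2))
  then have "(\<Sum>v\<in>sign_strings d. h (f v)) / 2 ^ d \<le> 2 ^ d * h (avg d f) / 2 ^ d"
    by (rule divide_right_mono) simp
  then show ?thesis unfolding avg_def[of d "\<lambda>v. h (f v)"] by simp
qed

lemma supported_two_point:
  assumes "supported h" "0 \<le> t" "t \<le> 1" "0 \<le> x" "x \<le> 1" "0 \<le> y" "y \<le> 1"
  shows "t * h x + (1 - t) * h y \<le> h (t * x + (1 - t) * y)"
proof (cases "t * x + (1 - t) * y = 0")
  case True
  \<comment> \<open>Supporting lines exist only at positive points; here every term of positive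
    weight is evaluated at 0.\<close>
  then have "t * x = 0" "(1 - t) * y = 0"
    using assms by (simp_all add: add_nonneg_eq_0_iff)
  then show ?thesis using True by (auto simp: algebra_simps)
next
  case False
  have "t * x + (1 - t) * y \<le> t * 1 + (1 - t) * 1"
    using assms by (intro add_mono mult_left_mono) auto
  moreover have "0 < t * x + (1 - t) * y"
    using False assms by (simp add: order_less_le)
  ultimately obtain s c where sc: "h (t * x + (1 - t) * y) = s * (t * x + (1 - t) * y) + c"
      "\<And>x. 0 \<le> x \<Longrightarrow> x \<le> 1 \<Longrightarrow> h x \<le> s * x + c"
    using assms(1) unfolding supported_def
    by (metis (no_types, lifting) diff_add_cancel mult.right_neutral add.commute)
  have "t * h x + (1 - t) * h y \<le> t * (s * x + c) + (1 - t) * (s * y + c)"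
    using assms sc(2) by (intro add_mono mult_left_mono) auto
  then show ?thesis unfolding sc(1) by (simp add: algebra_simps)
qed

text \<open>Weighted inequality of arithmetic and geometric means, obtained from
  \<open>ln z \<le> z - 1\<close> at y / \<mu> and 1 / \<mu>.\<close>

lemma exp_ln_weighted_le:
  assumes "0 \<le> \<gamma>" "\<gamma> \<le> 1" "(y::real) > 0"
  shows "exp (\<gamma> * ln y) \<le> 1 - \<gamma> + \<gamma> * y"
proof -
  define \<mu> where "\<mu> = 1 - \<gamma> + \<gamma> * y"
  have \<mu>: "\<mu> > 0"
  proof (cases "\<gamma> = 1")
    case False
    then show ?thesis using assms unfolding \<mu>_def by (intro add_pos_nonneg) auto
  qed (use assms in \<open>simp add: \<mu>_def\<close>)
  have "\<gamma> * ln (y / \<mu>) + (1 - \<gamma>) * ln (1 / \<mu>) \<le> \<gamma> * (y / \<mu> - 1) + (1 - \<gamma>) * (1 / \<mu> - 1)"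
    using assms \<mu> by (intro add_mono mult_left_mono ln_le_minus_one) auto
  also have "\<dots> = (1 - \<gamma> + \<gamma> * y) / \<mu> - 1"
    using \<mu> by (simp add: field_simps)
  also have "\<dots> = 0" using \<mu> by (simp add: \<mu>_def)
  finally have "\<gamma> * ln y \<le> ln \<mu>"
    using assms \<mu> by (simp add: ln_div algebra_simps)
  then have "exp (\<gamma> * ln y) \<le> \<mu>" using \<mu> by (metis exp_ln exp_le_cancel_iff)
  then show ?thesis by (simp add: \<mu>_def)
qed

text \<open>The hypothesis bounds h (x) / h (p) by the power (x / p)^(1 - \<beta>), and
  \<open>exp_ln_weighted_le\<close> bounds this power by its tangent at x = p. The resulting line
  has slope (1 - \<beta>) h (p) / p and intercept \<beta> h (p), both nonnegative.\<close>

lemma supportedI: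
  assumes "h 0 = 0"
    and "\<And>p. 0 < p \<Longrightarrow> p \<le> 1 \<Longrightarrow> 0 \<le> h p \<and> (\<exists>\<beta>\<ge>0. \<beta> \<le> 1 \<and>
      (\<forall>x. 0 < x \<and> x \<le> 1 \<longrightarrow> h x \<le> h p * (x / p * exp (\<beta> * ln (p / x)))))"
  shows "supported h"
  unfolding supported_def
proof (intro allI impI)
  fix p :: real assume p: "0 < p \<and> p \<le> 1"
  obtain \<beta> where \<beta>: "0 \<le> h p" "0 \<le> \<beta>" "\<beta> \<le> 1"
      "\<And>x. 0 < x \<Longrightarrow> x \<le> 1 \<Longrightarrow> h x \<le> h p * (x / p * exp (\<beta> * ln (p / x)))"
    using assms(2)[of p] p by blast
  have "h x \<le> h p * (1 - \<beta>) / p * x + \<beta> * h p" if "0 \<le> x" "x \<le> 1" for x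
  proof (cases "x = 0")
    case False
    then have x: "0 < x" using that by simp
    have "x / p * exp (\<beta> * ln (p / x)) = exp ((1 - \<beta>) * ln (x / p))"
    proof -
      have "(1 - \<beta>) * ln (x / p) = ln (x / p) + \<beta> * ln (p / x)"
        using x p by (simp add: ln_div algebra_simps)
      then show ?thesis using x p by (simp add: exp_add)
    qed
    also have "\<dots> \<le> \<beta> + (1 - \<beta>) * (x / p)"
      using exp_ln_weighted_le[of "1 - \<beta>" "x / p"] \<beta> x p by simp
    finally have "h p * (x / p * exp (\<beta> * ln (p / x))) \<le> h p * (\<beta> + (1 - \<beta>) * (x / p))"
      using \<beta>(1) by (rule mult_left_mono)
    with \<beta>(4)[OF x that(2)] show ?thesis by (simp add: algebra_simps)
  qed (use assms(1) \<beta> in simp)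
  moreover have "h p = h p * (1 - \<beta>) / p * p + \<beta> * h p"
    using p by (simp add: field_simps)
  ultimately show "\<exists>s\<ge>0. \<exists>c\<ge>0. h p = s * p + c \<and> (\<forall>x. 0 \<le> x \<and> x \<le> 1 \<longrightarrow> h x \<le> s * x + c)"
    using \<beta> p by (intro exI[of _ "h p * (1 - \<beta>) / p"] exI[of _ "\<beta> * h p"] conjI) auto
qed

section \<open>Perturbed powers, level weights and the envelope of \<open>Lambda\<close>\<close>

lemma add_le_mult_exp:
  assumes "(A::real) > 0"
  shows "A + t \<le> A * exp (t / A)"
proof -
  have "A * (1 + t / A) \<le> A * exp (t / A)"
    using assms by (intro mult_left_mono exp_ge_add_one_self) auto
  moreover have "A * (1 + t / A) = A + t" using assms by (simp add: distrib_left)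
  ultimately show ?thesis by simp
qed

text \<open>The increment is t / k so that the k-th power accumulates exactly exp (t / A). The sign
  of t is free; nonnegativity of the perturbed base is what permits taking powers.\<close>

lemma sqrt_power_add_le:
  assumes "(A::real) > 0" "0 \<le> A + t / real k" "k \<ge> 1"
  shows "sqrt ((A + t / real k) ^ k) \<le> sqrt (A ^ k) * exp (t / (2 * A))"
proof -
  have "(A + t / real k) ^ k \<le> (A * exp (t / real k / A)) ^ k"
    using assms add_le_mult_exp[of A "t / real k"] by (intro power_mono) auto
  also have "\<dots> = A ^ k * exp (t / A)"
    using assms by (simp add: power_mult_distrib exp_of_nat_mult[symmetric])
  also have "\<dots> = A ^ k * (exp (t / (2 * A))) ^ 2"
    by (simp add: exp_double[symmetric])
  finally have "sqrt ((A + t / real k) ^ k) \<le> sqrt (A ^ k * (exp (t / (2 * A))) ^ 2)"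
    by (rule real_sqrt_le_mono)
  then show ?thesis by (simp add: real_sqrt_mult)
qed

lemma ln_exp_div_ge_1:
  assumes "0 < p" "p \<le> (1::real)" "1 \<le> c"
  shows "1 \<le> ln (exp 1 * c / p)"
proof -
  have "exp 1 * 1 \<le> exp 1 * (c / p)" using assms by (intro mult_left_mono) (auto simp: field_simps)
  then have "exp 1 \<le> exp 1 * c / p" by simp
  then have "ln (exp 1) \<le> ln (exp 1 * c / p)" using assms by (subst ln_le_cancel_iff) auto
  then show ?thesis by simp
qed

text \<open>The dependence on the density in the level-one and level-two hypotheses, without the
  binomial and the power of C. The exponent j - 1 removes the second logarithm at level one.\<close>

definition level_weight :: "nat \<Rightarrow> nat \<Rightarrow> real \<Rightarrow> real" where
  "level_weight n j p = p * (sqrt (ln (exp 1 / p)) * sqrt (ln (exp 1 * real n / p)) ^ (j - 1))"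

lemma level_weight_0 [simp]: "level_weight n j 0 = 0"
  by (simp add: level_weight_def)

lemma level_weight_nonneg: "0 \<le> p \<Longrightarrow> p \<le> 1 \<Longrightarrow> n \<ge> 1 \<Longrightarrow> 0 \<le> level_weight n j p"
proof (cases "p = 0")
  case False
  assume "0 \<le> p" "p \<le> 1" "n \<ge> 1"
  with False have "0 \<le> p" "1 \<le> ln (exp 1 / p)" "1 \<le> ln (exp 1 * real n / p)"
    using ln_exp_div_ge_1[of p 1] ln_exp_div_ge_1[of p "real n"] by auto
  then show ?thesis
    unfolding level_weight_def
    by (intro mult_nonneg_nonneg zero_le_power real_sqrt_ge_zero) linarith+
qed simp

lemma supported_level_weight:
  assumes "n \<ge> 1" "j \<in> {1, 2}"
  shows "supported (level_weight n j)"
proof (rule supportedI)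
  fix p :: real assume p: "0 < p" "p \<le> 1"
  define A where "A = ln (exp 1 / p)"
  define B where "B = ln (exp 1 * real n / p)"
  have AB: "1 \<le> A" "1 \<le> B"
    unfolding A_def B_def using ln_exp_div_ge_1[OF p, of 1] ln_exp_div_ge_1[OF p, of "real n"] assms
    by auto
  \<comment> \<open>Minus the derivative, with respect to ln p, of the logarithm of the product of
    square roots. Each summand is at most 1 / 2 because A and B are at least 1.\<close>
  define \<beta> where "\<beta> = 1 / (2 * A) + real (j - 1) / (2 * B)"
  have "1 / (2 * A) \<le> 1 / 2" "real (j - 1) / (2 * B) \<le> 1 / 2"
    using AB assms(2) by (auto simp: field_simps)
  then have "\<beta> \<le> 1" unfolding \<beta>_def by linarith
  moreover have "0 \<le> \<beta>" unfolding \<beta>_def using AB by simp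
  ultimately have \<beta>: "0 \<le> \<beta>" "\<beta> \<le> 1" by auto
  have "level_weight n j x \<le> level_weight n j p * (x / p * exp (\<beta> * ln (p / x)))"
    if x: "0 < x" "x \<le> 1" for x
  proof -
    define t where "t = ln (p / x)"
    have Ax: "ln (exp 1 / x) = A + t / real 1" and Bx: "ln (exp 1 * real n / x) = B + t / real 1"
      using x p assms unfolding A_def B_def t_def by (simp_all add: ln_div ln_mult)
    have nonneg: "0 \<le> A + t / real 1" "0 \<le> B + t / real 1"
      using ln_exp_div_ge_1[OF x, of 1] ln_exp_div_ge_1[OF x, of "real n"] assms Ax Bx by auto
    have "sqrt (A + t / real 1) \<le> sqrt A * exp (t / (2 * A))"
      using sqrt_power_add_le[of A t 1] AB nonneg by simp
    moreover have "sqrt (B + t / real 1) ^ (j - 1) \<le> (sqrt B * exp (t / (2 * B))) ^ (j - 1)"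
      using sqrt_power_add_le[of B t 1] AB nonneg by (intro power_mono) auto
    moreover have "(sqrt B * exp (t / (2 * B))) ^ (j - 1)
        = sqrt B ^ (j - 1) * exp (real (j - 1) / (2 * B) * t)"
      by (simp add: power_mult_distrib exp_of_nat_mult[symmetric])
    ultimately have "sqrt (A + t / real 1) * sqrt (B + t / real 1) ^ (j - 1)
        \<le> sqrt A * exp (t / (2 * A)) * (sqrt B ^ (j - 1) * exp (real (j - 1) / (2 * B) * t))"
      using nonneg AB by (intro mult_mono) auto
    also have "\<dots> = sqrt A * sqrt B ^ (j - 1) * exp (\<beta> * t)"
      unfolding \<beta>_def by (simp add: exp_add algebra_simps)
    finally have "x * (sqrt (A + t / real 1) * sqrt (B + t / real 1) ^ (j - 1))
        \<le> x * (sqrt A * sqrt B ^ (j - 1) * exp (\<beta> * t))"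
      using x by (intro mult_left_mono) auto
    then show ?thesis
      unfolding level_weight_def Ax Bx A_def[symmetric] B_def[symmetric] t_def[symmetric]
      using p by (simp add: field_simps)
  qed
  then show "0 \<le> level_weight n j p \<and> (\<exists>\<beta>\<ge>0. \<beta> \<le> 1 \<and> (\<forall>x. 0 < x \<and> x \<le> 1 \<longrightarrow>
      level_weight n j x \<le> level_weight n j p * (x / p * exp (\<beta> * ln (p / x)))))"
    using \<beta> p assms by (intro conjI level_weight_nonneg exI[of _ \<beta>]) auto
qed simp

text \<open>The first branch of \<^const>\<open>Lambda\<close>, continued to all of the unit interval.\<close>

definition Lambda_env :: "nat \<Rightarrow> nat \<Rightarrow> real \<Rightarrow> real" where
  "Lambda_env m k p = p * sqrt ((ln (exp 1 * real m) + (ln (1 / p) - ln (real m)) / real k) ^ k)"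

lemma Lambda_env_0 [simp]: "Lambda_env m k 0 = 0"
  by (simp add: Lambda_env_def)

text \<open>For p > 1 / m the quotient is negative, but never below - ln m, and ln (e m) = 1 + ln m
  compensates. A base Z \<ge> 1 makes 1 / (2 Z) an admissible \<beta> in
  \<open>supportedI\<close>.\<close>

lemma Lambda_env_base_ge_1:
  assumes "m \<ge> 1" "k \<ge> 1" "0 < p" "p \<le> (1::real)"
  shows "1 \<le> ln (exp 1 * real m) + (ln (1 / p) - ln (real m)) / real k"
proof -
  have "0 \<le> ln (1 / p)" using assms by simp
  then have "- ln (real m) / real k \<le> (ln (1 / p) - ln (real m)) / real k"
    using assms by (intro divide_right_mono) auto
  moreover have "ln (real m) / real k \<le> ln (real m)"
    using assms by (simp add: divide_le_eq mult_le_cancel_left1)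
  moreover have "ln (exp 1 * real m) = 1 + ln (real m)"
    using assms by (simp add: ln_mult)
  ultimately show ?thesis by linarith
qed

lemma supported_Lambda_env:
  assumes "m \<ge> 1" "k \<ge> 1"
  shows "supported (Lambda_env m k)"
proof (rule supportedI)
  fix p :: real assume p: "0 < p" "p \<le> 1"
  define Z where "Z = ln (exp 1 * real m) + (ln (1 / p) - ln (real m)) / real k"
  have Z: "1 \<le> Z" unfolding Z_def by (rule Lambda_env_base_ge_1[OF assms p])
  have "Lambda_env m k x \<le> Lambda_env m k p * (x / p * exp (1 / (2 * Z) * ln (p / x)))"
    if x: "0 < x" "x \<le> 1" for x
  proof -
    define t where "t = ln (p / x)"
    have Zx: "ln (exp 1 * real m) + (ln (1 / x) - ln (real m)) / real k = Z + t / real k"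
      using x p assms unfolding Z_def t_def by (simp add: ln_div diff_divide_distrib)
    have "0 \<le> Z + t / real k"
      using Lambda_env_base_ge_1[OF assms x] unfolding Zx by simp
    then have "sqrt ((Z + t / real k) ^ k) \<le> sqrt (Z ^ k) * exp (t / (2 * Z))"
      using Z assms by (intro sqrt_power_add_le) auto
    then have "x * sqrt ((Z + t / real k) ^ k) \<le> x * (sqrt (Z ^ k) * exp (t / (2 * Z)))"
      using x by (intro mult_left_mono) auto
    then show ?thesis
      unfolding Lambda_env_def Zx Z_def[symmetric] t_def[symmetric]
      using p by (simp add: field_simps)
  qed
  moreover have "1 / (2 * Z) \<le> 1" using Z by simp
  moreover have "0 \<le> Lambda_env m k p" unfolding Lambda_env_def Z_def[symmetric] using Z p by simp
  ultimately show "0 \<le> Lambda_env m k p \<and> (\<exists>\<beta>\<ge>0. \<beta> \<le> 1 \<and> (\<forall>x. 0 < x \<and> x \<le> 1 \<longrightarrow>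
      Lambda_env m k x \<le> Lambda_env m k p * (x / p * exp (\<beta> * ln (p / x)))))"
    using Z by (intro conjI exI[of _ "1 / (2 * Z)"]) auto
qed simp

text \<open>This is the bound for a density u spread evenly over m monomials. The division by m
  cancels ln m in the envelope, so that ln (e m) is corrected only by ln (1 / u) / k.\<close>

lemma Lambda_env_scaled:
  assumes "m \<ge> 1" "k \<ge> 1" "0 < u"
  shows "real m * Lambda_env m k (u / real m)
    = u * sqrt ((ln (exp 1 * real m) + ln (1 / u) / real k) ^ k)"
proof -
  have "ln (1 / (u / real m)) - ln (real m) = ln (1 / u)"
    using assms by (simp add: ln_div)
  then show ?thesis unfolding Lambda_env_def using assms by simp
qed

text \<open>Up to the factor \<open>p\<^sup>2\<close>, the square of \<^const>\<open>Lambda\<close> is the maximum of \<open>B * M ^ (k - 1)\<close> over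
  \<open>B + (k - 1) * M = ln (e / p) + (k - 1) * ln (e * m)\<close> and \<open>M \<ge> ln (e * m)\<close>;
  the two branches tell whether the last constraint is active.\<close>

lemma Lambda_parameters:
  assumes "m \<ge> 1" "k \<ge> 1" "0 < p" "p \<le> (1::real)"
  obtains B M where "Lambda m k p = p * sqrt (B * M ^ (k - 1))"
    "B + real (k - 1) * M = ln (exp 1 / p) + real (k - 1) * ln (exp 1 * real m)"
    "1 \<le> B" "B \<le> ln (exp 1 / p)" "ln (exp 1 * real m) \<le> M" "B \<le> M"
    "B = M \<or> B = ln (exp 1 / p) \<and> M = ln (exp 1 * real m)"
proof (cases "p \<le> 1 / real m")
  case True
  define X where "X = ln (exp 1 / p)"
  define L where "L = ln (exp 1 * real m)"
  define B where "B = 1 / real k * ln (exp 1 ^ k * real m ^ (k - 1) / p)"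
  have k: "real (k - 1) = real k - 1" using assms by simp
  have "ln (exp 1 ^ k * real m ^ (k - 1) / p) = real k + real (k - 1) * ln (real m) - ln p"
    using assms by (simp add: ln_div ln_mult ln_realpow)
  also have "\<dots> = X + real (k - 1) * L"
    using assms by (simp add: X_def L_def ln_div ln_mult k algebra_simps)
  finally have B: "real k * B = X + real (k - 1) * L" using assms by (simp add: B_def)
  \<comment> \<open>The branch condition says L \<le> X. Since B is the mean of X and k - 1 copies
    of L, it lies between them.\<close>
  have "ln p \<le> ln (1 / real m)" using True assms by (subst ln_le_cancel_iff) auto
  then have LX: "L \<le> X" using assms by (simp add: X_def L_def ln_div ln_mult)
  have "real k * L \<le> real k * B" unfolding B k using LX by (simp add: algebra_simps)
  then have LB: "L \<le> B" using assms by simp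
  have "real k * B \<le> real k * X" unfolding B using LX mult_left_mono[OF LX, of "real (k - 1)"] k
    by (simp add: algebra_simps)
  then have BX: "B \<le> X" using assms by simp
  have L1: "1 \<le> L" unfolding L_def using assms ln_exp_div_ge_1[of 1 "real m"] by simp
  have "Lambda m k p = p * sqrt (B ^ k)"
    using True assms by (simp add: Lambda_def B_def)
  also have "B ^ k = B * B ^ (k - 1)" using assms by (cases k) auto
  finally have "Lambda m k p = p * sqrt (B * B ^ (k - 1))" .
  moreover have "B + real (k - 1) * B = X + real (k - 1) * L"
    using B unfolding k by (simp add: algebra_simps)
  ultimately show ?thesis
    using that[of B B] LB BX L1 unfolding X_def L_def by simp
next
  case False
  define X where "X = ln (exp 1 / p)"
  define L where "L = ln (exp 1 * real m)"
  have "Lambda m k p = p * sqrt (X * L ^ (k - 1))"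
  proof -
    have "p \<noteq> 0" using assms by simp
    then show ?thesis by (simp only: Lambda_def X_def L_def if_not_P[OF False] if_False)
  qed
  moreover have "1 \<le> X" unfolding X_def using assms ln_exp_div_ge_1[of p 1] by simp
  moreover have "X \<le> L"
  proof -
    have "1 / p \<le> real m" using False assms by (simp add: field_simps)
    then have "exp 1 * (1 / p) \<le> exp 1 * real m" by (intro mult_left_mono) auto
    then show ?thesis unfolding X_def L_def using assms by (subst ln_le_cancel_iff) auto
  qed
  ultimately show ?thesis using that[of X L] by (simp add: X_def L_def)
qed

lemma Lambda_nonneg:
  assumes "m \<ge> 1" "k \<ge> 1" "0 \<le> p" "p \<le> (1::real)"
  shows "0 \<le> Lambda m k p"
proof (cases "p = 0")
  case False
  then obtain B M where *: "Lambda m k p = p * sqrt (B * M ^ (k - 1))" "1 \<le> B" "B \<le> M"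
    using Lambda_parameters[of m k p] assms by (metis order_less_le)
  then have "0 \<le> B * M ^ (k - 1)" by (intro mult_nonneg_nonneg) auto
  then show ?thesis unfolding * using assms by simp
qed (simp add: Lambda_def)

text \<open>The base Z of the envelope is the mean of B and k - 1 copies of M, so this is the
  inequality of arithmetic and geometric means.\<close>

lemma Lambda_le_env:
  assumes "m \<ge> 1" "k \<ge> 1" "0 \<le> p" "p \<le> (1::real)"
  shows "Lambda m k p \<le> Lambda_env m k p"
proof (cases "p = 0")
  case False
  then have p: "0 < p" using assms by simp
  obtain B M where *: "Lambda m k p = p * sqrt (B * M ^ (k - 1))"
      "B + real (k - 1) * M = ln (exp 1 / p) + real (k - 1) * ln (exp 1 * real m)"
      "1 \<le> B" "B \<le> M"
    by (rule Lambda_parameters[OF assms(1,2) p assms(4)])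
  define Z where "Z = ln (exp 1 * real m) + (ln (1 / p) - ln (real m)) / real k"
  have k: "real (k - 1) = real k - 1" using assms by simp
  have Z: "1 \<le> Z" unfolding Z_def by (rule Lambda_env_base_ge_1[OF assms(1,2) p assms(4)])
  have "real k * Z = real k * ln (exp 1 * real m) + (ln (1 / p) - ln (real m))"
    unfolding Z_def using assms by (simp add: distrib_left)
  then have kZ: "real k * Z = B + real (k - 1) * M"
    unfolding *(2) using assms p by (simp add: k ln_div ln_mult algebra_simps)
  \<comment> \<open>The deviations of the k factors from Z add up to 0, so the exponentials multiply
    to 1.\<close>
  have exp_le: "y \<le> Z * exp ((y - Z) / Z)" for y
    using add_le_mult_exp[of Z "y - Z"] Z by simp
  have "B * M ^ (k - 1) \<le> Z * exp ((B - Z) / Z) * (Z * exp ((M - Z) / Z)) ^ (k - 1)"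
    using exp_le[of B] exp_le[of M] *(3,4) Z by (intro mult_mono power_mono) auto
  also have "\<dots> = Z ^ k * exp ((B - Z) / Z + real (k - 1) * ((M - Z) / Z))"
    using assms by (simp add: power_mult_distrib exp_add exp_of_nat_mult[symmetric] power_eq_if[of Z k])
  also have "(B - Z) / Z + real (k - 1) * ((M - Z) / Z) = (B + real (k - 1) * M - real k * Z) / Z"
  proof -
    have "(B - Z) / Z + r * ((M - Z) / Z) = (B + r * M - (r + 1) * Z) / Z" for r
      using Z by (simp add: diff_divide_distrib add_divide_distrib algebra_simps)
    moreover have "real (k - 1) + 1 = real k" using k by simp
    ultimately show ?thesis by metis
  qed
  also have "\<dots> = 0" using kZ by simp
  finally have "B * M ^ (k - 1) \<le> Z ^ k" by simp
  then show ?thesis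
    unfolding *(1) Lambda_env_def Z_def[symmetric] using p by (intro mult_left_mono) auto
qed (simp add: Lambda_def)

section \<open>Seminorms of leaf labellings\<close>

text \<open>Labellings are functions on all lists; the last clause makes the seminorm depend on the
  leaves only.\<close>

definition string_seminorm :: "nat \<Rightarrow> ((real list \<Rightarrow> real) \<Rightarrow> real) \<Rightarrow> bool" where
  "string_seminorm d \<nu> \<longleftrightarrow>
     (\<forall>f g. \<nu> (\<lambda>v. f v + g v) \<le> \<nu> f + \<nu> g) \<and>
     (\<forall>c f. \<nu> (\<lambda>v. c * f v) = \<bar>c\<bar> * \<nu> f) \<and>
     (\<forall>f g. (\<forall>v\<in>sign_strings d. f v = g v) \<longrightarrow> \<nu> f = \<nu> g)"

lemma string_seminormD:
  assumes "string_seminorm d \<nu>"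
  shows "\<nu> (\<lambda>v. f v + g v) \<le> \<nu> f + \<nu> g" "\<nu> (\<lambda>v. c * f v) = \<bar>c\<bar> * \<nu> f"
    "(\<And>v. v \<in> sign_strings d \<Longrightarrow> f v = g v) \<Longrightarrow> \<nu> f = \<nu> g"
  using assms unfolding string_seminorm_def by blast+

lemma string_seminorm_sum_le:
  assumes "string_seminorm d \<nu>" "finite A"
  shows "\<nu> (\<lambda>v. \<Sum>i\<in>A. f i v) \<le> (\<Sum>i\<in>A. \<nu> (f i))"
  using assms(2)
proof (induction A rule: finite_induct)
  case empty
  then show ?case using string_seminormD(2)[OF assms(1), of 0 "\<lambda>_. 0"] by simp
next
  case (insert i A)
  have "\<nu> (\<lambda>v. f i v + (\<Sum>i\<in>A. f i v)) \<le> \<nu> (f i) + \<nu> (\<lambda>v. \<Sum>i\<in>A. f i v)"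
    by (rule string_seminormD(1)[OF assms(1)])
  also have "\<dots> \<le> \<nu> (f i) + (\<Sum>i\<in>A. \<nu> (f i))"
    using insert.IH by simp
  finally show ?case using insert.hyps by simp
qed

text \<open>A labelling with values in the unit interval is an average of labellings with values in
  \<open>{-1, 0, 1}\<close>: round one fractional label at a time.\<close>

lemma seminorm_rounding:
  assumes \<nu>: "string_seminorm d \<nu>" and h: "supported h"
    and bound: "\<And>f. (\<And>v. v \<in> sign_strings d \<Longrightarrow> f v \<in> {-1, 0, 1}) \<Longrightarrow> \<nu> f \<le> h (avg d (\<lambda>v. \<bar>f v\<bar>))"
    and "\<And>v. v \<in> sign_strings d \<Longrightarrow> \<bar>f v\<bar> \<le> 1"
  shows "\<nu> f \<le> h (avg d (\<lambda>v. \<bar>f v\<bar>))"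
  using assms(4)
proof (induction "card {v \<in> sign_strings d. f v \<notin> {-1, 0, 1}}" arbitrary: f rule: less_induct)
  case less
  have avg01: "0 \<le> avg d (\<lambda>v. \<bar>g v\<bar>)" "avg d (\<lambda>v. \<bar>g v\<bar>) \<le> 1"
    if "\<And>v. v \<in> sign_strings d \<Longrightarrow> \<bar>g v\<bar> \<le> 1" for g
    using avg_mono[of d "\<lambda>v. \<bar>g v\<bar>" "\<lambda>_. 1"] that by (auto intro!: avg_nonneg)
  show ?case
  proof (cases "\<exists>v\<in>sign_strings d. f v \<notin> {-1, 0, 1}")
    case False
    then show ?thesis by (intro bound) blast
  next
    case True
    then obtain w where w: "w \<in> sign_strings d" "f w \<notin> {-1, 0, 1}" by blast
    define t where "t = \<bar>f w\<bar>"
    have t: "0 \<le> t" "t \<le> 1" using less.prems[OF w(1)] by (auto simp: t_def)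
    \<comment> \<open>With weights t and 1 - t, f is the average of \<open>f1\<close> and
      \<open>f0\<close>. The same holds for the absolute values, since \<open>sgn\<close> keeps the
      sign at w, so concavity of h applies to the two densities.\<close>
    define f1 where "f1 = f(w := sgn (f w))"
    define f0 where "f0 = f(w := 0)"
    have smaller: "card {v \<in> sign_strings d. g v \<notin> {-1, 0, 1}}
        < card {v \<in> sign_strings d. f v \<notin> {-1, 0, 1}}"
      if "g w \<in> {-1, 0, 1}" "\<And>v. v \<noteq> w \<Longrightarrow> g v = f v" for g
    proof (rule psubset_card_mono)
      have "w \<notin> {v \<in> sign_strings d. g v \<notin> {-1, 0, 1}}" using that(1) by blast
      moreover have "w \<in> {v \<in> sign_strings d. f v \<notin> {-1, 0, 1}}" using w by blast
      moreover have "{v \<in> sign_strings d. g v \<notin> {-1, 0, 1}} \<subseteq> {v \<in> sign_strings d. f v \<notin> {-1, 0, 1}}"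
      proof (intro subsetI CollectI conjI; elim CollectE conjE)
        fix v assume v: "v \<in> sign_strings d" "g v \<notin> {-1, 0, 1}"
        then have "v \<noteq> w" using that(1) by metis
        then show "f v \<notin> {-1, 0, 1}" using that(2) v(2) by metis
      qed
      ultimately show "{v \<in> sign_strings d. g v \<notin> {-1, 0, 1}}
          \<subset> {v \<in> sign_strings d. f v \<notin> {-1, 0, 1}}" by blast
    qed simp
    have b1: "\<bar>f1 v\<bar> \<le> 1" and b0: "\<bar>f0 v\<bar> \<le> 1" if "v \<in> sign_strings d" for v
      using less.prems[OF that] by (auto simp: f1_def f0_def sgn_if)
    have IH1: "\<nu> f1 \<le> h (avg d (\<lambda>v. \<bar>f1 v\<bar>))"
      by (rule less.hyps[OF smaller b1]) (auto simp: f1_def sgn_if)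
    have IH0: "\<nu> f0 \<le> h (avg d (\<lambda>v. \<bar>f0 v\<bar>))"
      by (rule less.hyps[OF smaller b0]) (auto simp: f0_def)
    have f: "f = (\<lambda>v. t * f1 v + (1 - t) * f0 v)"
      by (rule ext) (auto simp: f1_def f0_def t_def sgn_if algebra_simps)
    have absf: "(\<lambda>v. \<bar>f v\<bar>) = (\<lambda>v. t * \<bar>f1 v\<bar> + (1 - t) * \<bar>f0 v\<bar>)"
      using w(2) by (intro ext) (auto simp: f1_def f0_def t_def sgn_if algebra_simps)
    have "\<nu> f \<le> \<nu> (\<lambda>v. t * f1 v) + \<nu> (\<lambda>v. (1 - t) * f0 v)"
      by (subst f) (rule string_seminormD(1)[OF \<nu>])
    also have "\<dots> = t * \<nu> f1 + (1 - t) * \<nu> f0"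
      using t by (simp only: string_seminormD(2)[OF \<nu>])
    also have "\<dots> \<le> t * h (avg d (\<lambda>v. \<bar>f1 v\<bar>)) + (1 - t) * h (avg d (\<lambda>v. \<bar>f0 v\<bar>))"
      using t IH1 IH0 by (intro add_mono mult_left_mono) auto
    also have "\<dots> \<le> h (t * avg d (\<lambda>v. \<bar>f1 v\<bar>) + (1 - t) * avg d (\<lambda>v. \<bar>f0 v\<bar>))"
      by (intro supported_two_point h t avg01 b1 b0)
    also have "t * avg d (\<lambda>v. \<bar>f1 v\<bar>) + (1 - t) * avg d (\<lambda>v. \<bar>f0 v\<bar>) = avg d (\<lambda>v. \<bar>f v\<bar>)"
      unfolding absf by (simp add: avg_add avg_cmult)
    finally show ?thesis .
  qed
qed

lemma seminorm_rounding_scaled: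
  assumes \<nu>: "string_seminorm d \<nu>" and h: "supported h"
    and bound: "\<And>f. (\<And>v. v \<in> sign_strings d \<Longrightarrow> f v \<in> {-1, 0, 1}) \<Longrightarrow> \<nu> f \<le> h (avg d (\<lambda>v. \<bar>f v\<bar>))"
    and "\<And>v. v \<in> sign_strings d \<Longrightarrow> \<bar>f v\<bar> \<le> M" "0 < M"
  shows "\<nu> f \<le> M * h (avg d (\<lambda>v. \<bar>f v\<bar>) / M)"
proof -
  have "\<nu> (\<lambda>v. f v / M) \<le> h (avg d (\<lambda>v. \<bar>f v / M\<bar>))"
    using assms(4,5) by (intro seminorm_rounding[OF \<nu> h bound]) (auto simp: field_simps)
  moreover have "(\<lambda>v. \<bar>f v / M\<bar>) = (\<lambda>v. 1 / M * \<bar>f v\<bar>)"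
    using assms(5) by (intro ext) simp
  ultimately have "M * \<nu> (\<lambda>v. f v / M) \<le> M * h (avg d (\<lambda>v. \<bar>f v\<bar>) / M)"
    using assms(5) by (simp only: avg_cmult) simp
  moreover have "\<nu> (\<lambda>v. M * (f v / M)) = M * \<nu> (\<lambda>v. f v / M)"
    using string_seminormD(2)[OF \<nu>, of M "\<lambda>v. f v / M"] assms(5) by simp
  moreover have "(\<lambda>v. M * (f v / M)) = f" using assms(5) by simp
  ultimately show ?thesis by simp
qed

text \<open>Each U has its own labelling, bounded by M, with density y U after division by M. These
  densities add up to at most u over at most m indices, and Jensen's inequality yields m times the
  envelope at u / m.\<close>

lemma sum_seminorm_le:
  assumes \<nu>: "string_seminorm d \<nu>" and "finite A" "card A \<le> m" "m \<ge> 1" "k \<ge> 1" "0 \<le> \<kappa>"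
    and bound: "\<And>f. (\<And>v. v \<in> sign_strings d \<Longrightarrow> f v \<in> {-1, 0, 1}) \<Longrightarrow>
      \<nu> f \<le> \<kappa> * Lambda_env m k (avg d (\<lambda>v. \<bar>f v\<bar>))"
    and F: "\<And>v. v \<in> sign_strings d \<Longrightarrow> (\<Sum>U\<in>A. \<bar>F v U\<bar>) \<le> M" "0 < M"
    and u: "avg d (\<lambda>v. \<Sum>U\<in>A. \<bar>F v U\<bar>) \<le> M * u" "0 < u" "u \<le> 1"
  shows "(\<Sum>U\<in>A. \<nu> (\<lambda>v. F v U))
    \<le> \<kappa> * M * u * sqrt ((ln (exp 1 * real m) + ln (1 / u) / real k) ^ k)"
proof -
  let ?H = "Lambda_env m k"
  have sup: "supported ?H" by (rule supported_Lambda_env[OF assms(4,5)])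
  have sup': "supported (\<lambda>p. \<kappa> * ?H p)"
    unfolding supported_def
  proof (intro allI impI)
    fix p :: real assume "0 < p \<and> p \<le> 1"
    then obtain s c where sc: "s \<ge> 0" "c \<ge> 0" "?H p = s * p + c"
        "\<And>x. 0 \<le> x \<Longrightarrow> x \<le> 1 \<Longrightarrow> ?H x \<le> s * x + c"
      using sup unfolding supported_def by meson
    have "\<kappa> * ?H x \<le> \<kappa> * s * x + \<kappa> * c" if "0 \<le> x" "x \<le> 1" for x
      using mult_left_mono[OF sc(4)[OF that] assms(6)] by (simp add: algebra_simps)
    then show "\<exists>s\<ge>0. \<exists>c\<ge>0. \<kappa> * ?H p = s * p + c \<and> (\<forall>x. 0 \<le> x \<and> x \<le> 1 \<longrightarrow> \<kappa> * ?H x \<le> s * x + c)"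
      using sc(1-3) assms(6)
      by (intro exI[of _ "\<kappa> * s"] exI[of _ "\<kappa> * c"]) (auto simp: algebra_simps)
  qed
  define y where "y U = avg d (\<lambda>v. \<bar>F v U\<bar>) / M" for U
  have F1: "\<bar>F v U\<bar> \<le> M" if "v \<in> sign_strings d" "U \<in> A" for v U
    using member_le_sum[of U A "\<lambda>U. \<bar>F v U\<bar>"] F(1)[OF that(1)] that(2) assms(2) by simp
  have y: "0 \<le> y U \<and> y U \<le> 1" if "U \<in> A" for U
  proof -
    have "avg d (\<lambda>v. \<bar>F v U\<bar>) \<le> avg d (\<lambda>_. M)" using F1 that by (intro avg_mono) auto
    then show ?thesis using F(2) by (auto simp: y_def divide_le_eq intro!: avg_nonneg divide_nonneg_pos)
  qed
  have "(\<Sum>U\<in>A. \<nu> (\<lambda>v. F v U)) \<le> (\<Sum>U\<in>A. M * (\<kappa> * ?H (y U)))"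
    unfolding y_def using F1 F(2)
    by (intro sum_mono seminorm_rounding_scaled[OF \<nu> sup' bound]) auto
  also have "\<dots> = M * \<kappa> * (\<Sum>U\<in>A. ?H (y U))"
    by (simp add: sum_distrib_left mult.assoc)
  also have "\<dots> \<le> M * \<kappa> * (real m * ?H (u / real m))"
  proof (intro mult_left_mono)
    show "(\<Sum>U\<in>A. ?H (y U)) \<le> real m * ?H (u / real m)"
    proof (rule supported_sum_le[OF sup assms(2)])
      show "0 < u / real m" "u / real m \<le> 1" using u assms(4) by (auto simp: divide_le_eq)
      have "(\<Sum>U\<in>A. y U) = avg d (\<lambda>v. \<Sum>U\<in>A. \<bar>F v U\<bar>) / M"
        by (simp add: y_def avg_sum sum_divide_distrib)
      also have "\<dots> \<le> u" using u(1) F(2) by (simp add: divide_le_eq mult.commute)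
      finally show "(\<Sum>U\<in>A. y U) \<le> real m * (u / real m)" using assms(4) by simp
    qed (use assms(3) y in auto)
  qed (use F(2) assms(6) in auto)
  also have "\<dots> = \<kappa> * M * u * sqrt ((ln (exp 1 * real m) + ln (1 / u) / real k) ^ k)"
    unfolding Lambda_env_scaled[OF assms(4,5) u(2)] by (simp add: mult_ac)
  finally show ?thesis .
qed

section \<open>Summation over density scales\<close>

lemma exp_1_ge_2: "2 \<le> exp (1::real)"
  using exp_ge_add_one_self[of 1] by simp

lemma cube_le_exp: "0 \<le> y \<Longrightarrow> y ^ 3 \<le> 27 * exp (y - 3)" for y :: real
proof -
  assume "0 \<le> y"
  have "y / 3 \<le> exp (y / 3 - 1)" using exp_ge_add_one_self[of "y / 3 - 1"] by simp
  then have "(y / 3) ^ 3 \<le> exp (y / 3 - 1) ^ 3" using \<open>0 \<le> y\<close> by (intro power_mono) auto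
  also have "\<dots> = exp (y - 3)" by (simp add: exp_of_nat_mult[symmetric])
  finally show ?thesis by (simp add: power_divide)
qed

lemma fourth_le_exp: "0 \<le> y \<Longrightarrow> y ^ 4 \<le> 256 * exp (y - 4)" for y :: real
proof -
  assume "0 \<le> y"
  have "y / 4 \<le> exp (y / 4 - 1)" using exp_ge_add_one_self[of "y / 4 - 1"] by simp
  then have "(y / 4) ^ 4 \<le> exp (y / 4 - 1) ^ 4" using \<open>0 \<le> y\<close> by (intro power_mono) auto
  also have "\<dots> = exp (y - 4)" by (simp add: exp_of_nat_mult[symmetric])
  finally show ?thesis by (simp add: power_divide)
qed

text \<open>After squaring, 2^j y^(j + 2) exp (1 - y) has to be bounded. The estimates for y^3 and
  y^4 leave 54 / e^2 and 1024 / e^3, which lie below 4^2 and 12^2. Decay like 1 / y is enough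
  because y will run through powers of 2.\<close>

lemma scale_term_le:
  assumes "(y::real) \<ge> 1" "j \<in> {1, 2}"
  shows "sqrt (2 * y) ^ j * exp ((1 - y) / 2) \<le> (if j = 1 then 4 else 12) / y"
proof (rule power2_le_imp_le)
  have e: "exp (1 - y) = exp ((1 - y) / 2) ^ 2" by (simp add: exp_double[symmetric])
  have "(sqrt (2 * y) ^ j * exp ((1 - y) / 2)) ^ 2 = (2 * y) ^ j * exp (1 - y)"
    unfolding e using assms by (auto simp: power_mult_distrib power2_eq_square)
  also have "\<dots> \<le> ((if j = 1 then 4 else 12) / y) ^ 2"
  proof (cases "j = 1")
    case True
    have "2 * y ^ 3 * exp (1 - y) \<le> 2 * (27 * exp (y - 3)) * exp (1 - y)"
      using cube_le_exp[of y] assms by (intro mult_mono) auto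
    also have "\<dots> = 54 / (exp 1) ^ 2"
      by (simp add: exp_diff exp_double[symmetric] exp_minus field_simps exp_add[symmetric])
    also have "\<dots> \<le> 54 / 2 ^ 2"
      using exp_1_ge_2 by (intro divide_left_mono power_mono mult_pos_pos) auto
    also have "\<dots> \<le> 16" by simp
    finally show ?thesis using True assms by (simp add: field_simps power2_eq_square power3_eq_cube)
  next
    case False
    then have j: "j = 2" using assms by simp
    have "4 * y ^ 4 * exp (1 - y) \<le> 4 * (256 * exp (y - 4)) * exp (1 - y)"
      using fourth_le_exp[of y] assms by (intro mult_mono) auto
    also have "\<dots> = 1024 / (exp 1) ^ 3"
      by (simp add: exp_of_nat_mult[symmetric] exp_diff exp_minus field_simps exp_add[symmetric])
    also have "\<dots> \<le> 1024 / 2 ^ 3"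
      using exp_1_ge_2 by (intro divide_left_mono power_mono mult_pos_pos) auto
    also have "\<dots> \<le> 144" by simp
    finally show ?thesis using j assms by (simp add: field_simps power2_eq_square power4_eq_xxxx)
  qed
  finally show "(sqrt (2 * y) ^ j * exp ((1 - y) / 2)) ^ 2 \<le> ((if j = 1 then 4 else 12) / y) ^ 2" .
qed (use assms in auto)

lemma scale_sum_le:
  assumes "j \<in> {1, 2}"
  shows "(\<Sum>i<N. sqrt (2 * 2 ^ i) ^ j * exp ((1 - 2 ^ i) / 2)) \<le> (if j = 1 then 8 else 24)"
proof -
  let ?c = "if j = 1 then 4 else 12 :: real"
  have "(\<Sum>i<N. sqrt (2 * 2 ^ i) ^ j * exp ((1 - 2 ^ i) / 2)) \<le> (\<Sum>i<N. ?c * (1 / 2) ^ i)"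
    using scale_term_le[OF _ assms, of "2 ^ i" for i] by (intro sum_mono) (auto simp: power_divide)
  also have "\<dots> = ?c * (\<Sum>i<N. (1 / 2) ^ i)" by (simp add: sum_distrib_left)
  also have "(\<Sum>i<N. (1 / 2 :: real) ^ i) \<le> 2" by (subst sum_gp_strict) (simp add: field_simps)
  finally show ?thesis by (auto split: if_splits)
qed

text \<open>For the leaves with ln (e / a) \<le> B, where only a \<le> 1 is used. The relation
  between B and M turns k L + ln (1 / p) into k M plus at most j M, which costs exp (j / 2) whatever
  k is.\<close>

lemma head_factor_le:
  assumes k: "k \<ge> 1" and j: "j \<ge> 1" and p: "0 < p" "p \<le> 1"
    and eq: "B + real (k + j - 1) * M = ln (exp 1 / p) + real (k + j - 1) * L"
    and B: "B \<le> M" and L: "1 \<le> L" "L \<le> M"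
  shows "p * sqrt ((L + ln (1 / p) / real k) ^ k) \<le> p * sqrt (M ^ k) * exp (real j / 2)"
proof -
  have kj: "real (k + j - 1) = real k + (real j - 1)" using k j by simp
  have "real k * L + ln (1 / p) = real k * M + (B + (real j - 1) * (M - L) - 1)"
    using eq p unfolding kj by (simp add: ln_div algebra_simps)
  moreover have "(real j - 1) * (M - L) \<le> (real j - 1) * M"
    using j L by (intro mult_left_mono) auto
  ultimately have "real k * (L + ln (1 / p) / real k) \<le> real k * (M + real j * M / real k)"
    using B k by (simp add: distrib_left algebra_simps)
  then have le: "L + ln (1 / p) / real k \<le> M + real j * M / real k" using k by simp
  have "0 \<le> ln (1 / p)" using p by simp
  then have "0 \<le> L + ln (1 / p) / real k" using L by (intro add_nonneg_nonneg) auto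
  with le have "sqrt ((L + ln (1 / p) / real k) ^ k) \<le> sqrt ((M + real j * M / real k) ^ k)"
    by (intro real_sqrt_le_mono power_mono)
  also have "\<dots> \<le> sqrt (M ^ k) * exp (real j * M / (2 * M))"
    using L k j by (intro sqrt_power_add_le add_nonneg_nonneg divide_nonneg_nonneg) auto
  also have "real j * M / (2 * M) = real j / 2" using L by simp
  finally show ?thesis using p by (simp add: mult.assoc)
qed

text \<open>\<open>A\<close> bounds every density a with ln (e / a) \<ge> y B, and \<open>P\<close>
  bounds the average of a over such leaves. The gain exp ((1 - y) / 2) comes from the base of the
  power if B = M, and from A itself if M = L.\<close>

lemma tail_factor_le:
  assumes k: "k \<ge> 1" and j: "j \<ge> 1" and p: "0 < p" "p \<le> 1" and y: "1 \<le> y"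
    and eq: "B + real (k + j - 1) * M = ln (exp 1 / p) + real (k + j - 1) * L"
    and B: "1 \<le> B" and L: "1 \<le> L" "L \<le> M"
    and alt: "B = M \<or> B = ln (exp 1 / p) \<and> M = L"
  defines "A \<equiv> exp (1 - y * B)"
  defines "P \<equiv> min p A"
  shows "P * sqrt ((L + ln (A / P) / real k) ^ k)
    \<le> p * sqrt (M ^ k) * exp ((1 - y) / 2) * exp ((real j - 1) / 2)"
  using alt
proof
  assume BM: "B = M"
  have kj: "real (k + j - 1) = real k + (real j - 1)" using k j by simp
  have pos: "0 < A" "0 < P" "P \<le> p" "P \<le> A" using p by (auto simp: A_def P_def)
  have "1 \<le> A / P" using pos by (simp add: field_simps)
  then have lnAP: "0 \<le> ln (A / P)" using pos by simp
  \<comment> \<open>k times the shift of the base away from M. As B = M, the term (1 - y) * B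
    contributes exactly (1 - y) / 2 to the exponent; the cost of ln (p / P) is paid by P \<le>
    p.\<close>
  define E where "E = (real j - 1) * (M - L) + (1 - y) * B + ln (p / P)"
  have "ln (A / P) = 1 - y * B - ln P"
    using pos by (simp add: ln_div) (simp add: A_def)
  then have "real k * L + ln (A / P) = real k * M + E"
    using eq p pos unfolding kj E_def by (simp add: ln_div algebra_simps)
  then have "real k * (L + ln (A / P) / real k) = real k * (M + E / real k)"
    using k by (simp add: distrib_left)
  then have ME: "L + ln (A / P) / real k = M + E / real k" using k by simp
  have "0 \<le> M + E / real k"
    unfolding ME[symmetric] using L lnAP by (intro add_nonneg_nonneg) auto
  then have le: "sqrt ((M + E / real k) ^ k) \<le> sqrt (M ^ k) * exp (E / (2 * M))"
    using L k by (intro sqrt_power_add_le) auto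
  have lnpP: "0 \<le> ln (p / P)" using pos p by simp
  have "E / (2 * M) = (real j - 1) * ((M - L) / (2 * M)) + (1 - y) / 2 + ln (p / P) / (2 * M)"
    unfolding E_def BM using L by (simp add: add_divide_distrib)
  also have "\<dots> \<le> (real j - 1) * (1 / 2) + (1 - y) / 2 + ln (p / P) / 2"
    using L lnpP j by (intro add_mono mult_left_mono order_refl divide_left_mono) (auto simp: field_simps)
  finally have "exp (E / (2 * M)) \<le> exp ((real j - 1) * (1 / 2) + (1 - y) / 2 + ln (p / P) / 2)"
    by simp
  also have "\<dots> = exp ((1 - y) / 2) * exp ((real j - 1) / 2) * exp (ln (p / P) / 2)"
    by (simp add: exp_add)
  finally have le2: "exp (E / (2 * M)) \<le> exp ((1 - y) / 2) * exp ((real j - 1) / 2) * exp (ln (p / P) / 2)" .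
  have "exp (ln (p / P) / 2) \<le> exp (ln (p / P))" using lnpP by simp
  also have "\<dots> = p / P" using pos p by simp
  finally have "P * exp (ln (p / P) / 2) \<le> p" using pos by (simp add: field_simps)
  have "P * sqrt ((L + ln (A / P) / real k) ^ k)
      \<le> P * (sqrt (M ^ k) * (exp ((1 - y) / 2) * exp ((real j - 1) / 2) * exp (ln (p / P) / 2)))"
    unfolding ME using pos L
    by (intro mult_left_mono order_trans[OF le] le2) auto
  also have "\<dots> = sqrt (M ^ k) * exp ((1 - y) / 2) * exp ((real j - 1) / 2) * (P * exp (ln (p / P) / 2))"
    by (simp add: mult_ac)
  also have "\<dots> \<le> sqrt (M ^ k) * exp ((1 - y) / 2) * exp ((real j - 1) / 2) * p"
    using L \<open>P * exp (ln (p / P) / 2) \<le> p\<close> by (intro mult_left_mono) auto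
  finally show ?thesis by (simp add: mult_ac)
next
  assume BX: "B = ln (exp 1 / p) \<and> M = L"
  \<comment> \<open>Here B = 1 - ln p, so A is smaller than p by the required factor. Hence P = A,
    the logarithm of A / P vanishes, and the base is exactly M.\<close>
  have "1 - y * B = ln p - (y - 1) * B"
    using BX p by (simp add: ln_div algebra_simps)
  also have "\<dots> \<le> ln p + (1 - y) / 2"
  proof -
    have "(y - 1) * (1 / 2) \<le> (y - 1) * B" using y B by (intro mult_left_mono) auto
    then show ?thesis by (simp add: field_simps)
  qed
  finally have "A \<le> exp (ln p + (1 - y) / 2)" unfolding A_def by simp
  then have A: "A \<le> p * exp ((1 - y) / 2)" using p by (simp add: exp_add)
  also have "\<dots> \<le> p * 1" using p y by (intro mult_left_mono) auto
  finally have "P = A" by (simp add: P_def)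
  moreover have "0 < A" by (simp add: A_def)
  ultimately have "P * sqrt ((L + ln (A / P) / real k) ^ k) = A * sqrt (M ^ k)"
    using BX by simp
  also have "\<dots> \<le> p * exp ((1 - y) / 2) * sqrt (M ^ k) * exp ((real j - 1) / 2)"
  proof -
    have "A * sqrt (M ^ k) * 1 \<le> p * exp ((1 - y) / 2) * sqrt (M ^ k) * exp ((real j - 1) / 2)"
      using A L j p by (intro mult_mono) auto
    then show ?thesis by simp
  qed
  finally show ?thesis by (simp add: mult_ac)
qed

text \<open>Within one scale both logarithms are replaced by fixed quantities, which makes the
  weight linear in a and its average controllable by that of a. The additional ln n fits because 2
  ln n \<le> M.\<close>

lemma level_weight_le:
  assumes "n \<ge> 1" "j \<in> {1, 2}" "0 < a" "a \<le> 1" "ln (exp 1 / a) \<le> z * B" "1 \<le> z" "1 \<le> B"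
    and "B \<le> M" "ln (exp 1 * real (n\<^sup>2)) \<le> M"
  shows "level_weight n j a \<le> sqrt z ^ j * (sqrt B * sqrt (2 * M) ^ (j - 1)) * a"
proof -
  have "ln (exp 1 * real n / a) = ln (exp 1 / a) + ln (real n)"
    using assms by (simp add: ln_div ln_mult)
  moreover have "2 * ln (real n) \<le> M"
    using assms(1,9) by (simp add: ln_mult ln_realpow)
  moreover have "z * B \<le> z * M" "1 * M \<le> z * M"
    using assms by (intro mult_left_mono mult_right_mono; linarith)+
  ultimately have n: "ln (exp 1 * real n / a) \<le> z * (2 * M)"
    using assms(5,7,8) by linarith
  have ge1: "1 \<le> ln (exp 1 / a)" "1 \<le> ln (exp 1 * real n / a)"
    using ln_exp_div_ge_1[of a 1] ln_exp_div_ge_1[of a "real n"] assms(1,3,4) by auto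
  have 1: "sqrt (ln (exp 1 / a)) \<le> sqrt (z * B)"
    using assms(5) by (rule real_sqrt_le_mono)
  have 2: "sqrt (ln (exp 1 * real n / a)) ^ (j - 1) \<le> sqrt (z * (2 * M)) ^ (j - 1)"
    using n ge1 by (intro power_mono real_sqrt_le_mono real_sqrt_ge_zero) linarith+
  have "0 \<le> z * B" using assms(6,7) by simp
  then have "sqrt (ln (exp 1 / a)) * sqrt (ln (exp 1 * real n / a)) ^ (j - 1)
      \<le> sqrt (z * B) * sqrt (z * (2 * M)) ^ (j - 1)"
    using ge1(2) by (intro mult_mono[OF 1 2] real_sqrt_ge_zero zero_le_power) linarith+
  then have "level_weight n j a \<le> a * (sqrt (z * B) * sqrt (z * (2 * M)) ^ (j - 1))"
    unfolding level_weight_def using assms(3) by (intro mult_left_mono) auto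
  also have "\<dots> = sqrt z ^ j * (sqrt B * sqrt (2 * M) ^ (j - 1)) * a"
    using assms(2) by (auto simp: real_sqrt_mult power2_eq_square)
  finally show ?thesis .
qed

text \<open>Minimality of i gives the lower bound through its predecessor; at i = 0 there is
  none.\<close>

lemma scale_index_exists:
  assumes "(0::real) < B"
  obtains i :: nat where "X \<le> 2 * 2 ^ i * B" "i = 0 \<or> 2 ^ i * B < X"
proof -
  obtain n where "X / B < 2 ^ n" using real_arch_pow[of 2 "X / B"] by auto
  then have "X < 2 ^ n * B" using assms by (simp add: divide_less_eq)
  moreover have "2 ^ n * B \<le> 2 * 2 ^ n * B" using assms by simp
  ultimately have ex: "\<exists>i. X \<le> 2 * 2 ^ i * B" by (intro exI[of _ n]) linarith
  define i where "i = (LEAST i. X \<le> 2 * 2 ^ i * B)"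
  have 1: "X \<le> 2 * 2 ^ i * B" unfolding i_def by (rule LeastI_ex[OF ex])
  have "i = 0 \<or> 2 ^ i * B < X"
  proof (cases i)
    case (Suc i')
    then have "\<not> X \<le> 2 * 2 ^ i' * B" using not_less_Least[of i' "\<lambda>i. X \<le> 2 * 2 ^ i * B"] i_def by simp
    then show ?thesis using Suc by simp
  qed simp
  with 1 show ?thesis by (rule that)
qed

text \<open>The leaves are split according to the scale of \<open>ln (e / a v)\<close>; on each scale the labels are
  rounded separately, since rounding all labels against a common bound would be too lossy.\<close>

lemma seminorm_composition:
  fixes F :: "real list \<Rightarrow> 'u \<Rightarrow> real"
  assumes \<nu>: "string_seminorm d \<nu>" and A: "finite A" "card A \<le> n\<^sup>2" and n: "n \<ge> 1"
    and k: "k \<ge> 1" and j: "j \<in> {1, 2}" and \<kappa>: "0 \<le> \<kappa>"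
    and bound: "\<And>f. (\<And>v. v \<in> sign_strings d \<Longrightarrow> f v \<in> {-1, 0, 1}) \<Longrightarrow>
      \<nu> f \<le> \<kappa> * Lambda_env (n\<^sup>2) k (avg d (\<lambda>v. \<bar>f v\<bar>))"
    and a: "\<And>v. v \<in> sign_strings d \<Longrightarrow> 0 \<le> a v \<and> a v \<le> 1"
    and D: "0 < D"
    and F: "\<And>v. v \<in> sign_strings d \<Longrightarrow> (\<Sum>U\<in>A. \<bar>F v U\<bar>) \<le> D * level_weight n j (a v)"
    and p: "0 < avg d a"
  shows "(\<Sum>U\<in>A. \<nu> (\<lambda>v. F v U)) \<le> \<kappa> * D * 12 ^ j * Lambda (n\<^sup>2) (k + j) (avg d a)"
proof -
  define p where "p = avg d a"
  define L where "L = ln (exp 1 * real (n\<^sup>2))"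
  have n2: "n\<^sup>2 \<ge> 1" using n by simp
  have p0: "0 < p" using assms(12) by (simp add: p_def)
  have "p \<le> avg d (\<lambda>_. 1)" unfolding p_def using a by (intro avg_mono) auto
  then have p1: "p \<le> 1" by simp
  have kj1: "k + j \<ge> 1" "j \<ge> 1" using k j by auto
  obtain B M where Lam: "Lambda (n\<^sup>2) (k + j) p = p * sqrt (B * M ^ (k + j - 1))"
    and eq: "B + real (k + j - 1) * M = ln (exp 1 / p) + real (k + j - 1) * L"
    and B: "1 \<le> B" "B \<le> ln (exp 1 / p)" and LM: "L \<le> M" and BM: "B \<le> M"
    and alt: "B = M \<or> B = ln (exp 1 / p) \<and> M = L"
    unfolding L_def by (rule Lambda_parameters[OF n2 kj1(1) p0 p1])
  have "(1::real) \<le> real (n\<^sup>2)" using n by simp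
  then have L1: "1 \<le> L" unfolding L_def using ln_exp_div_ge_1[of 1 "real (n\<^sup>2)"] by simp
  define R where "R = sqrt B * sqrt (2 * M) ^ (j - 1)"
  have R: "0 < R" unfolding R_def using B BM by simp
  \<comment> \<open>At \<open>a v = 0\<close> this value carries no meaning; \<open>weight\<close>
    and \<open>small\<close> treat such leaves by a separate case.\<close>
  define X where "X v = ln (exp 1 / a v)" for v
  have "\<exists>\<iota>. \<forall>v. X v \<le> 2 * 2 ^ \<iota> v * B \<and> (\<iota> v = 0 \<or> 2 ^ \<iota> v * B < X v)"
    using scale_index_exists[of B] B by (intro choice allI) (metis less_le_trans zero_less_one)
  then obtain \<iota> :: "real list \<Rightarrow> nat" where \<iota>: "\<And>v. X v \<le> 2 * 2 ^ \<iota> v * B"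
      "\<And>v. \<iota> v = 0 \<or> 2 ^ \<iota> v * B < X v" by blast
  \<comment> \<open>Leaves with X v \<le> B form group 0. In group Suc i the bound 2^i B < X v then
    holds also for i = 0, where the choice of \<iota> alone gives no lower bound.\<close>
  define \<gamma> where "\<gamma> v = (if X v \<le> B then 0 else Suc (\<iota> v))" for v
  define N where "N = Max (\<gamma> ` sign_strings d)"
  have N: "\<gamma> v \<le> N" if "v \<in> sign_strings d" for v
    unfolding N_def using that by (intro Max_ge) auto
  define Fi where "Fi i v U = (if \<gamma> v = i then F v U else 0)" for i v U
  \<comment> \<open>In one group, Q bounds the single densities, P their average, and s is the slope
    of the linear bound on the weight. The labels are then rounded against D s Q, with relative
    density P / Q.\<close>
  have group: "(\<Sum>U\<in>A. \<nu> (\<lambda>v. Fi i v U))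
      \<le> \<kappa> * D * s * (P * sqrt ((L + ln (Q / P) / real k) ^ k))"
    if s: "0 < s" and P: "0 < P" "P \<le> Q" "avg d (\<lambda>v. if \<gamma> v = i then a v else 0) \<le> P"
      and v: "\<And>v. v \<in> sign_strings d \<Longrightarrow> \<gamma> v = i \<Longrightarrow> a v \<le> Q \<and> level_weight n j (a v) \<le> s * a v"
    for i s P Q
  proof -
    have abs: "(\<Sum>U\<in>A. \<bar>Fi i v U\<bar>) \<le> D * s * (if \<gamma> v = i then a v else 0)"
      if "v \<in> sign_strings d" for v
    proof (cases "\<gamma> v = i")
      case True
      have "D * level_weight n j (a v) \<le> D * (s * a v)"
        using v[OF that True] D by (intro mult_left_mono) auto
      then show ?thesis using F[OF that] True by (simp add: Fi_def mult.assoc)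
    qed (simp add: Fi_def)
    have "(\<Sum>U\<in>A. \<nu> (\<lambda>v. Fi i v U))
        \<le> \<kappa> * (D * s * Q) * (P / Q) * sqrt ((ln (exp 1 * real (n\<^sup>2)) + ln (1 / (P / Q)) / real k) ^ k)"
    proof (rule sum_seminorm_le[OF \<nu> A n2 k \<kappa> bound])
      fix w assume w: "w \<in> sign_strings d"
      have "D * s * (if \<gamma> w = i then a w else 0) \<le> D * s * Q"
        using v[OF w] P D s by (intro mult_left_mono) auto
      with abs[OF w] show "(\<Sum>U\<in>A. \<bar>Fi i w U\<bar>) \<le> D * s * Q" by linarith
    next
      have "avg d (\<lambda>v. \<Sum>U\<in>A. \<bar>Fi i v U\<bar>) \<le> avg d (\<lambda>v. D * s * (if \<gamma> v = i then a v else 0))"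
        by (intro avg_mono abs)
      also have "\<dots> \<le> D * s * P"
        unfolding avg_cmult using P D s by (intro mult_left_mono) auto
      finally show "avg d (\<lambda>v. \<Sum>U\<in>A. \<bar>Fi i v U\<bar>) \<le> D * s * Q * (P / Q)" using P by simp
    qed (use P D s in auto)
    then show ?thesis using P unfolding L_def by (simp add: mult_ac)
  qed
  have weight: "level_weight n j (a v) \<le> sqrt z ^ j * R * a v"
    if "v \<in> sign_strings d" "X v \<le> z * B" "1 \<le> z" for v z
  proof (cases "a v = 0")
    case False
    then show ?thesis
      unfolding R_def using that a[OF that(1)] n j B BM LM unfolding X_def L_def
      by (intro level_weight_le) auto
  qed simp
  have cut: "avg d (\<lambda>v. if \<gamma> v = i then a v else 0) \<le> p" for i
    unfolding p_def using a by (intro avg_mono) auto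
  have head: "(\<Sum>U\<in>A. \<nu> (\<lambda>v. Fi 0 v U)) \<le> \<kappa> * D * (R * (p * sqrt (M ^ k) * exp (real j / 2)))"
  proof -
    have "(\<Sum>U\<in>A. \<nu> (\<lambda>v. Fi 0 v U)) \<le> \<kappa> * D * R * (p * sqrt ((L + ln (1 / p) / real k) ^ k))"
    proof (rule group)
      fix v assume v: "v \<in> sign_strings d" "\<gamma> v = 0"
      then have "X v \<le> 1 * B" by (auto simp: \<gamma>_def split: if_splits)
      from weight[OF v(1) this] show "a v \<le> 1 \<and> level_weight n j (a v) \<le> R * a v"
        using a[OF v(1)] by simp
    qed (use R p0 p1 cut in auto)
    also have "\<dots> \<le> \<kappa> * D * R * (p * sqrt (M ^ k) * exp (real j / 2))"
      using \<kappa> D R head_factor_le[OF k kj1(2) p0 p1 eq BM L1 LM] by (intro mult_left_mono) auto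
    finally show ?thesis by (simp add: mult.assoc)
  qed
  have tail: "(\<Sum>U\<in>A. \<nu> (\<lambda>v. Fi (Suc i) v U)) \<le> \<kappa> * D * (R * (p * sqrt (M ^ k) *
      (exp ((real j - 1) / 2) * (sqrt (2 * 2 ^ i) ^ j * exp ((1 - 2 ^ i) / 2)))))" for i
  proof -
    define Q where "Q = exp (1 - 2 ^ i * B)"
    define P where "P = min p Q"
    have small: "a v \<le> Q" if "v \<in> sign_strings d" "\<gamma> v = Suc i" for v
    proof (cases "a v = 0")
      case False
      then have av: "0 < a v" using a[OF that(1)] by simp
      have "\<not> X v \<le> B" "\<iota> v = i" using that(2) by (auto simp: \<gamma>_def split: if_splits)
      then have "2 ^ i * B \<le> X v" using \<iota>(2)[of v] by auto
      then have "2 ^ i * B \<le> 1 - ln (a v)" using av by (simp add: X_def ln_div)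
      then have "ln (a v) \<le> 1 - 2 ^ i * B" by simp
      then have "exp (ln (a v)) \<le> Q" unfolding Q_def by (subst exp_le_cancel_iff)
      then show ?thesis using av by simp
    qed (simp add: Q_def)
    have "avg d (\<lambda>v. if \<gamma> v = Suc i then a v else 0) \<le> avg d (\<lambda>_. Q)"
      using small by (intro avg_mono) (auto simp: Q_def)
    then have "avg d (\<lambda>v. if \<gamma> v = Suc i then a v else 0) \<le> P" using cut by (simp add: P_def)
    moreover have "0 < P" "P \<le> Q" using p0 by (auto simp: P_def Q_def)
    moreover have "level_weight n j (a v) \<le> sqrt (2 * 2 ^ i) ^ j * R * a v"
      if "v \<in> sign_strings d" "\<gamma> v = Suc i" for v
    proof (rule weight[OF that(1)])
      have "\<iota> v = i" using that(2) by (auto simp: \<gamma>_def split: if_splits)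
      then show "X v \<le> 2 * 2 ^ i * B" using \<iota>(1)[of v] by simp
      show "(1::real) \<le> 2 * 2 ^ i" using one_le_power[of "2::real" i] by linarith
    qed
    ultimately have "(\<Sum>U\<in>A. \<nu> (\<lambda>v. Fi (Suc i) v U))
        \<le> \<kappa> * D * (sqrt (2 * 2 ^ i) ^ j * R) * (P * sqrt ((L + ln (Q / P) / real k) ^ k))"
      using small R by (intro group) auto
    also have "\<dots> \<le> \<kappa> * D * (sqrt (2 * 2 ^ i) ^ j * R) *
        (p * sqrt (M ^ k) * exp ((1 - 2 ^ i) / 2) * exp ((real j - 1) / 2))"
      using \<kappa> D R tail_factor_le[OF k kj1(2) p0 p1 _ eq B(1) L1 LM alt, of "2 ^ i"]
      unfolding P_def Q_def by (intro mult_left_mono) auto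
    finally show ?thesis by (simp add: mult_ac)
  qed
  have "(\<Sum>U\<in>A. \<nu> (\<lambda>v. F v U)) \<le> (\<Sum>U\<in>A. \<Sum>i\<le>N. \<nu> (\<lambda>v. Fi i v U))"
  proof (rule sum_mono)
    fix U assume "U \<in> A"
    have "\<nu> (\<lambda>v. F v U) = \<nu> (\<lambda>v. \<Sum>i\<le>N. Fi i v U)"
      using N by (intro string_seminormD(3)[OF \<nu>]) (simp add: Fi_def)
    also have "\<dots> \<le> (\<Sum>i\<le>N. \<nu> (\<lambda>v. Fi i v U))"
      by (intro string_seminorm_sum_le[OF \<nu>]) simp
    finally show "\<nu> (\<lambda>v. F v U) \<le> (\<Sum>i\<le>N. \<nu> (\<lambda>v. Fi i v U))" .
  qed
  also have "\<dots> = (\<Sum>i\<le>N. \<Sum>U\<in>A. \<nu> (\<lambda>v. Fi i v U))" by (rule sum.swap)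
  also have "\<dots> = (\<Sum>U\<in>A. \<nu> (\<lambda>v. Fi 0 v U)) + (\<Sum>i<N. \<Sum>U\<in>A. \<nu> (\<lambda>v. Fi (Suc i) v U))"
    by (rule sum.atMost_shift)
  also have "\<dots> \<le> \<kappa> * D * (R * (p * sqrt (M ^ k) * exp (real j / 2)))
      + (\<Sum>i<N. \<kappa> * D * (R * (p * sqrt (M ^ k) *
      (exp ((real j - 1) / 2) * (sqrt (2 * 2 ^ i) ^ j * exp ((1 - 2 ^ i) / 2))))))"
    by (intro add_mono head sum_mono tail)
  also have "\<dots> = \<kappa> * D * (R * (p * sqrt (M ^ k) * (exp (real j / 2) + exp ((real j - 1) / 2) *
      (\<Sum>i<N. sqrt (2 * 2 ^ i) ^ j * exp ((1 - 2 ^ i) / 2)))))"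
    by (simp only: sum_distrib_left distrib_left)
  also have "\<dots> \<le> \<kappa> * D * (R * (p * sqrt (M ^ k) * (exp (real j / 2) + exp ((real j - 1) / 2) *
      (if j = 1 then 8 else 24))))"
    using \<kappa> D R p0 L1 LM by (intro mult_left_mono add_left_mono scale_sum_le j) auto
  also have "\<dots> = \<kappa> * D * (Lambda (n\<^sup>2) (k + j) p * (sqrt 2 ^ (j - 1) *
      (exp (real j / 2) + exp ((real j - 1) / 2) * (if j = 1 then 8 else 24))))"
  proof -
    have "R * sqrt (M ^ k) = sqrt 2 ^ (j - 1) * sqrt (B * M ^ (k + j - 1))"
      unfolding R_def using j by (auto simp: real_sqrt_mult real_sqrt_power power_add)
    then have "R * (p * sqrt (M ^ k) * c) = Lambda (n\<^sup>2) (k + j) p * (sqrt 2 ^ (j - 1) * c)" for c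
      unfolding Lam by (metis (no_types, lifting) mult.assoc mult.left_commute)
    then show ?thesis by simp
  qed
  \<comment> \<open>Origin of the constant 12. With e and its square root at most 3 and sqrt 2 at
    most 3 / 2, head and tail together give 3 + 8 = 11 for j = 1, and 3 / 2 times 3 + 72, which is
    below 144, for j = 2.\<close>
  also have "\<dots> \<le> \<kappa> * D * (Lambda (n\<^sup>2) (k + j) p * 12 ^ j)"
  proof (intro mult_left_mono)
    have e: "exp (1 :: real) \<le> 3" by (rule exp_le)
    have "exp (1 / 2 :: real) \<le> exp 1" by simp
    with e have e2: "exp (1 / 2 :: real) \<le> 3" by linarith
    have "sqrt 2 \<le> sqrt ((3 / 2)\<^sup>2)" by (intro real_sqrt_le_mono) (simp add: power2_eq_square)
    then have "sqrt 2 \<le> 3 / 2" by simp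
    then have "sqrt 2 * (exp 1 + exp (1 / 2) * 24) \<le> 3 / 2 * (3 + 3 * 24)"
      using e e2 by (intro mult_mono add_mono) auto
    with e2 j show "sqrt 2 ^ (j - 1) *
        (exp (real j / 2) + exp ((real j - 1) / 2) * (if j = 1 then 8 else 24)) \<le> 12 ^ j"
      by auto
  qed (use \<kappa> D Lambda_nonneg[OF n2 kj1(1) _ p1] p0 in auto)
  finally show ?thesis by (simp add: p_def mult_ac)
qed

lemma level_weight_avg_le:
  assumes "n \<ge> 1" "j \<in> {1, 2}" "\<And>v. v \<in> sign_strings d \<Longrightarrow> 0 \<le> f v \<and> f v \<le> 1"
  shows "avg d (\<lambda>v. level_weight n j (f v)) \<le> level_weight n j (avg d f)"
proof (cases "avg d f = 0")
  case True
  then have "f v = 0" if "v \<in> sign_strings d" for v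
    using avg_eq_0D[of d f v] assms(3) that by blast
  then have "avg d (\<lambda>v. level_weight n j (f v)) = avg d (\<lambda>_. 0)" by (intro avg_cong) simp
  then show ?thesis using True by simp
next
  case False
  moreover have "0 \<le> avg d f" using assms(3) by (intro avg_nonneg) auto
  ultimately show ?thesis
    by (intro supported_avg_le supported_level_weight assms) auto
qed

text \<open>Serves the uppermost block, above which nothing has to be composed. One always has ln (e
  / p) \<le> 2 B: either B is this logarithm, or j = 2 and B = M, when 2 B = ln (e / p) + L.\<close>

lemma level_weight_le_Lambda:
  assumes "n \<ge> 1" "j \<in> {1, 2}" "0 \<le> p" "p \<le> 1"
  shows "level_weight n j p \<le> 12 ^ j * Lambda (n\<^sup>2) j p"
proof (cases "p = 0")
  case False
  then have p: "0 < p" using assms by simp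
  have n2: "n\<^sup>2 \<ge> 1" "j \<ge> 1" using assms by auto
  define L where "L = ln (exp 1 * real (n\<^sup>2))"
  obtain B M where Lam: "Lambda (n\<^sup>2) j p = p * sqrt (B * M ^ (j - 1))"
    and eq: "B + real (j - 1) * M = ln (exp 1 / p) + real (j - 1) * L"
    and B: "1 \<le> B" "L \<le> M" "B \<le> M" and alt: "B = M \<or> B = ln (exp 1 / p) \<and> M = L"
    unfolding L_def by (rule Lambda_parameters[OF n2 p assms(4)])
  have "(1::real) \<le> real (n\<^sup>2)" using assms(1) by simp
  then have "1 \<le> L" unfolding L_def using ln_exp_div_ge_1[of 1 "real (n\<^sup>2)"] by simp
  then have "ln (exp 1 / p) \<le> 2 * B" using eq alt B assms(2) by auto
  then have "level_weight n j p \<le> sqrt 2 ^ j * (sqrt B * sqrt (2 * M) ^ (j - 1)) * p"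
    using assms p B unfolding L_def by (intro level_weight_le) auto
  also have "\<dots> = sqrt 2 ^ j * sqrt 2 ^ (j - 1) * Lambda (n\<^sup>2) j p"
    unfolding Lam using assms(2) by (auto simp: real_sqrt_mult)
  also have "\<dots> \<le> 12 ^ j * Lambda (n\<^sup>2) j p"
  proof (intro mult_right_mono Lambda_nonneg n2 assms)
    have "sqrt 2 \<le> sqrt (2\<^sup>2)" by (intro real_sqrt_le_mono) simp
    then have "sqrt 2 \<le> 2" by simp
    then show "sqrt 2 ^ j * sqrt 2 ^ (j - 1) \<le> 12 ^ j" using assms(2) by auto
  qed
  finally show ?thesis .
qed (simp add: Lambda_def)

section \<open>Splitting a tree between two levels\<close>

lemma prod_prefix:
  assumes "A \<subseteq> {1..a}" "length u = a"
  shows "(\<Prod>i\<in>A. (u @ w) ! (i - 1) * x (q (take (i - 1) (u @ w))))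
    = (\<Prod>i\<in>A. u ! (i - 1) * x (q (take (i - 1) u)))"
proof (rule prod.cong[OF refl])
  fix i assume "i \<in> A"
  then have "1 \<le> i" "i \<le> a" using assms(1) by auto
  then have "i - 1 < a" by simp
  then show "(u @ w) ! (i - 1) * x (q (take (i - 1) (u @ w))) = u ! (i - 1) * x (q (take (i - 1) u))"
    using assms(2) by (simp add: nth_append)
qed

lemma prod_suffix:
  assumes "B \<subseteq> {1..}" "length u = a"
  shows "(\<Prod>i\<in>(+) a ` B. (u @ w) ! (i - 1) * x (q (take (i - 1) (u @ w))))
    = (\<Prod>i\<in>B. w ! (i - 1) * x (q (u @ take (i - 1) w)))"
proof -
  have "(\<Prod>i\<in>(+) a ` B. (u @ w) ! (i - 1) * x (q (take (i - 1) (u @ w))))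
      = (\<Prod>i\<in>B. (u @ w) ! (a + i - 1) * x (q (take (a + i - 1) (u @ w))))"
    by (subst prod.reindex) (auto simp: comp_def)
  also have "\<dots> = (\<Prod>i\<in>B. w ! (i - 1) * x (q (u @ take (i - 1) w)))"
  proof (rule prod.cong[OF refl])
    fix i assume "i \<in> B"
    then have "1 \<le> i" using assms(1) by auto
    then obtain i' where "i = Suc i'" by (cases i) auto
    then show "(u @ w) ! (a + i - 1) * x (q (take (a + i - 1) (u @ w)))
        = w ! (i - 1) * x (q (u @ take (i - 1) w))"
      using assms(2) by (simp add: nth_append)
  qed
  finally show ?thesis .
qed

text \<open>No set of the family reaches below level c, so the rest r of a path only selects a
  label. The deep tree is an average of trees of depth c.\<close>

lemma tree_poly_truncate:
  assumes "\<E> \<subseteq> Pow {1..c}"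
  shows "tree_poly q (c + g) f \<E> x = avg g (\<lambda>r. tree_poly q c (\<lambda>w. f (w @ r)) \<E> x)"
proof -
  have "avg (c + g) (\<lambda>v. f v * (\<Prod>i\<in>S. v ! (i - 1) * x (q (take (i - 1) v))))
      = avg g (\<lambda>r. avg c (\<lambda>w. f (w @ r) * (\<Prod>i\<in>S. w ! (i - 1) * x (q (take (i - 1) w)))))"
    if "S \<in> \<E>" for S
  proof -
    have S: "S \<subseteq> {1..c}" using that assms by blast
    have "avg (c + g) (\<lambda>v. f v * (\<Prod>i\<in>S. v ! (i - 1) * x (q (take (i - 1) v))))
        = avg c (\<lambda>w. avg g (\<lambda>r. f (w @ r) * (\<Prod>i\<in>S. w ! (i - 1) * x (q (take (i - 1) w)))))"
      unfolding avg_append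
      by (intro avg_cong) (simp only: prod_prefix[OF S length_sign_strings])
    also have "\<dots> = avg g (\<lambda>r. avg c (\<lambda>w. f (w @ r) * (\<Prod>i\<in>S. w ! (i - 1) * x (q (take (i - 1) w)))))"
      unfolding avg_def by (simp only: sum_divide_distrib) (subst sum.swap, simp add: mult.commute)
    finally show ?thesis .
  qed
  then show ?thesis unfolding tree_poly_def by (simp add: avg_sum)
qed

text \<open>The levels up to a and those beyond it recover the pair. Hence sums over the join become
  double sums and cardinalities multiply.\<close>

lemma shifted_join_inj:
  fixes a c :: nat
  assumes "\<E> \<subseteq> Pow {1..a}" "\<F> \<subseteq> Pow {1..c}"
  shows "inj_on (\<lambda>(A, B). A \<union> (+) a ` B) (\<E> \<times> \<F>)"
proof (rule inj_onI, clarify)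
  fix A B A' B'
  assume *: "A \<in> \<E>" "B \<in> \<F>" "A' \<in> \<E>" "B' \<in> \<F>" "A \<union> (+) a ` B = A' \<union> (+) a ` B'"
  have sub: "A \<subseteq> {..a}" "(+) a ` B \<subseteq> {a<..}" if "A \<in> \<E>" "B \<in> \<F>" for A B
  proof -
    have AB: "A \<subseteq> {1..a}" "B \<subseteq> {1..c}" using that assms by blast+
    show "A \<subseteq> {..a}" using AB(1) by auto
    have "a + b \<in> {a<..}" if "b \<in> B" for b using subsetD[OF AB(2) that] by simp
    then show "(+) a ` B \<subseteq> {a<..}" by blast
  qed
  have disj: "{..a} \<inter> {a<..} = {}" by auto
  have A: "A = (A \<union> (+) a ` B) \<inter> {..a}" if "A \<in> \<E>" "B \<in> \<F>" for A B
    using sub[OF that] disj by blast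
  have B: "(+) a ` B = (A \<union> (+) a ` B) \<inter> {a<..}" if "A \<in> \<E>" "B \<in> \<F>" for A B
    using sub[OF that] disj by blast
  have "A = A'" using A[OF *(1,2)] A[OF *(3,4)] *(5) by simp
  moreover have "(+) a ` B = (+) a ` B'" using B[OF *(1,2)] B[OF *(3,4)] *(5) by simp
  then have "B = B'" by (simp add: inj_image_eq_iff)
  ultimately show "A = A' \<and> B = B'" by simp
qed

lemma shifted_join_image:
  "family_join \<E> ((`) ((+) a) ` \<F>) = (\<lambda>(A, B). A \<union> (+) a ` B) ` (\<E> \<times> \<F>)"
  unfolding family_join_def by auto

text \<open>At a node u of level a, the levels in A lie on the path to u and the shifted ones inside
  the subtree at u, whose polynomial therefore appears as a factor depending on u.\<close>

lemma tree_poly_split_levels: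
  assumes "\<E> \<subseteq> Pow {1..a}" "\<F> \<subseteq> Pow {1..c}"
  shows "tree_poly q (a + e) f (family_join \<E> ((`) ((+) a) ` \<F>)) x
    = (\<Sum>A\<in>\<E>. avg a (\<lambda>u. (\<Prod>i\<in>A. u ! (i - 1) * x (q (take (i - 1) u)))
        * tree_poly (\<lambda>w. q (u @ w)) e (\<lambda>w. f (u @ w)) \<F> x))"
proof -
  have fin: "finite \<E>" "finite \<F>" using assms finite_subset by blast+
  have "tree_poly q (a + e) f (family_join \<E> ((`) ((+) a) ` \<F>)) x
      = (\<Sum>(A, B)\<in>\<E> \<times> \<F>. avg (a + e) (\<lambda>v. f v *
          (\<Prod>i\<in>A \<union> (+) a ` B. v ! (i - 1) * x (q (take (i - 1) v)))))"
    unfolding tree_poly_def shifted_join_image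
    by (subst sum.reindex[OF shifted_join_inj[OF assms]]) (simp add: case_prod_unfold)
  also have "\<dots> = (\<Sum>(A, B)\<in>\<E> \<times> \<F>. avg a (\<lambda>u. (\<Prod>i\<in>A. u ! (i - 1) * x (q (take (i - 1) u)))
        * avg e (\<lambda>w. f (u @ w) * (\<Prod>i\<in>B. w ! (i - 1) * x (q (u @ take (i - 1) w))))))"
  proof (intro sum.cong refl, clarify)
    fix A B assume AB: "A \<in> \<E>" "B \<in> \<F>"
    have A: "A \<subseteq> {1..a}" "finite A" and B: "B \<subseteq> {1..}" "finite B"
      using AB assms finite_subset[of A "{1..a}"] finite_subset[of B "{1..c}"] by fastforce+
    have disj: "A \<inter> (+) a ` B = {}" using A(1) B(1) by fastforce
    show "avg (a + e) (\<lambda>v. f v * (\<Prod>i\<in>A \<union> (+) a ` B. v ! (i - 1) * x (q (take (i - 1) v))))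
        = avg a (\<lambda>u. (\<Prod>i\<in>A. u ! (i - 1) * x (q (take (i - 1) u)))
            * avg e (\<lambda>w. f (u @ w) * (\<Prod>i\<in>B. w ! (i - 1) * x (q (u @ take (i - 1) w)))))"
      unfolding avg_append
    proof (rule avg_cong)
      fix u assume "u \<in> sign_strings a"
      then have u: "length u = a" by (rule length_sign_strings)
      show "avg e (\<lambda>w. f (u @ w) *
            (\<Prod>i\<in>A \<union> (+) a ` B. (u @ w) ! (i - 1) * x (q (take (i - 1) (u @ w)))))
          = (\<Prod>i\<in>A. u ! (i - 1) * x (q (take (i - 1) u)))
            * avg e (\<lambda>w. f (u @ w) * (\<Prod>i\<in>B. w ! (i - 1) * x (q (u @ take (i - 1) w))))"
        unfolding avg_cmult[symmetric]
        by (subst prod.union_disjoint[OF A(2) finite_imageI[OF B(2)] disj])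
          (simp only: prod_prefix[OF A(1) u] prod_suffix[OF B(1) u] mult_ac)
    qed
  qed
  also have "\<dots> = (\<Sum>A\<in>\<E>. \<Sum>B\<in>\<F>. avg a (\<lambda>u. (\<Prod>i\<in>A. u ! (i - 1) * x (q (take (i - 1) u)))
        * avg e (\<lambda>w. f (u @ w) * (\<Prod>i\<in>B. w ! (i - 1) * x (q (u @ take (i - 1) w))))))"
    by (simp add: sum.cartesian_product)
  also have "\<dots> = (\<Sum>A\<in>\<E>. avg a (\<lambda>u. (\<Prod>i\<in>A. u ! (i - 1) * x (q (take (i - 1) u)))
        * tree_poly (\<lambda>w. q (u @ w)) e (\<lambda>w. f (u @ w)) \<F> x))"
    by (simp only: tree_poly_def sum_distrib_left avg_sum)
  finally show ?thesis .
qed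

section \<open>Norms of averaged trees and removal of one block\<close>

lemma fourier_norm_avg_le: "fourier_norm n (\<lambda>x. avg g (\<lambda>r. \<phi> r x)) \<le> avg g (\<lambda>r. fourier_norm n (\<phi> r))"
proof -
  have "fourier_norm n (\<lambda>x. avg g (\<lambda>r. \<phi> r x))
      = fourier_norm n (\<lambda>x. \<Sum>r\<in>sign_strings g. 1 / 2 ^ g * \<phi> r x)"
    by (simp add: avg_def sum_divide_distrib)
  also have "\<dots> \<le> (\<Sum>r\<in>sign_strings g. 1 / 2 ^ g * fourier_norm n (\<phi> r))"
    by (rule order_trans[OF fourier_norm_sum_le]) (simp only: fourier_norm_cmult, simp)
  finally show ?thesis by (simp add: avg_def sum_divide_distrib)
qed

lemma string_seminorm_tree_poly:
  "string_seminorm d (\<lambda>f. fourier_norm n (tree_poly q d f \<E>))"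
  unfolding string_seminorm_def
proof (intro conjI allI impI)
  fix f g :: "real list \<Rightarrow> real"
  have "tree_poly q d (\<lambda>v. f v + g v) \<E> = (\<lambda>x. tree_poly q d f \<E> x + tree_poly q d g \<E> x)"
    by (intro ext) (simp add: tree_poly_def avg_add distrib_right sum.distrib)
  then show "fourier_norm n (tree_poly q d (\<lambda>v. f v + g v) \<E>)
      \<le> fourier_norm n (tree_poly q d f \<E>) + fourier_norm n (tree_poly q d g \<E>)"
    using fourier_norm_add_le by metis
next
  fix c and f :: "real list \<Rightarrow> real"
  have "tree_poly q d (\<lambda>v. c * f v) \<E> = (\<lambda>x. c * tree_poly q d f \<E> x)"
    by (intro ext) (simp add: tree_poly_def avg_cmult mult.assoc sum_distrib_left)
  then show "fourier_norm n (tree_poly q d (\<lambda>v. c * f v) \<E>)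
      = \<bar>c\<bar> * fourier_norm n (tree_poly q d f \<E>)"
    using fourier_norm_cmult by metis
next
  fix f g :: "real list \<Rightarrow> real"
  assume "\<forall>v\<in>sign_strings d. f v = g v"
  then have "tree_poly q d f \<E> = tree_poly q d g \<E>"
    by (intro ext) (auto simp: tree_poly_def intro!: sum.cong avg_cong)
  then show "fourier_norm n (tree_poly q d f \<E>) = fourier_norm n (tree_poly q d g \<E>)" by simp
qed

text \<open>The two level hypotheses in the form the induction uses. Subtrees and truncations keep
  the variables 1, ..., n, so C and n are fixed while depth, queries and labels vary. The zero
  labelling is included.\<close>

locale level_estimate =
  fixes C :: real and n :: nat
  assumes C_ge_1: "C \<ge> 1" and n_ge_1: "n \<ge> 1"
    and level_estimate: "\<lbrakk> query_wf n d q; d \<ge> 1; \<And>v. v \<in> sign_strings d \<Longrightarrow> f v \<in> {-1, 0, 1};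
      j \<in> {1, 2} \<rbrakk> \<Longrightarrow> fourier_norm n (tree_poly q d f (subsets_of_size {1..d} j))
        \<le> sqrt (real (d choose j)) * C ^ j * level_weight n j (avg d (\<lambda>v. \<bar>f v\<bar>))"
begin

text \<open>The locale speaks of all levels of a tree, while a block may stop g levels above the
  leaves. Averaging over the tails keeps the binomial at c choose j, and concavity of
  \<open>level_weight\<close> merges the densities of the tails.\<close>

lemma level_estimate_truncated:
  assumes "query_wf n (c + g) q" "c \<ge> 1" "j \<in> {1, 2}"
    and f: "\<And>v. v \<in> sign_strings (c + g) \<Longrightarrow> f v \<in> {-1, 0, 1}"
  shows "fourier_norm n (tree_poly q (c + g) f (subsets_of_size {1..c} j))
    \<le> sqrt (real (c choose j)) * C ^ j * level_weight n j (avg (c + g) (\<lambda>v. \<bar>f v\<bar>))"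
proof -
  let ?E = "subsets_of_size {1..c} j"
  let ?K = "sqrt (real (c choose j)) * C ^ j"
  have "query_wf n c q" using query_wf_prefix[OF assms(1)] by simp
  then have bnd: "fourier_norm n (tree_poly q c (\<lambda>w. f (w @ r)) ?E)
      \<le> ?K * level_weight n j (avg c (\<lambda>w. \<bar>f (w @ r)\<bar>))" if "r \<in> sign_strings g" for r
    using append_sign_strings[OF _ that] f by (intro level_estimate assms) blast+
  have "\<bar>f v\<bar> \<le> 1" if "v \<in> sign_strings (c + g)" for v using f[OF that] by auto
  then have le1: "avg c (\<lambda>w. \<bar>f (w @ r)\<bar>) \<le> avg c (\<lambda>_. 1)" if "r \<in> sign_strings g" for r
    using append_sign_strings[OF _ that] by (intro avg_mono) blast
  have eq: "tree_poly q (c + g) f ?E = (\<lambda>x. avg g (\<lambda>r. tree_poly q c (\<lambda>w. f (w @ r)) ?E x))"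
    by (intro ext tree_poly_truncate) (auto simp: subsets_of_size_def)
  then have "fourier_norm n (tree_poly q (c + g) f ?E)
      = fourier_norm n (\<lambda>x. avg g (\<lambda>r. tree_poly q c (\<lambda>w. f (w @ r)) ?E x))"
    by (rule arg_cong)
  also have "\<dots> \<le> avg g (\<lambda>r. fourier_norm n (tree_poly q c (\<lambda>w. f (w @ r)) ?E))"
    by (rule fourier_norm_avg_le)
  also have "\<dots> \<le> avg g (\<lambda>r. ?K * level_weight n j (avg c (\<lambda>w. \<bar>f (w @ r)\<bar>)))"
    by (intro avg_mono bnd)
  also have "\<dots> \<le> ?K * level_weight n j (avg g (\<lambda>r. avg c (\<lambda>w. \<bar>f (w @ r)\<bar>)))"
    unfolding avg_cmult using le1 C_ge_1
    by (intro mult_left_mono level_weight_avg_le n_ge_1 assms conjI avg_nonneg mult_nonneg_nonneg) auto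
  also have "avg g (\<lambda>r. avg c (\<lambda>w. \<bar>f (w @ r)\<bar>)) = avg (c + g) (\<lambda>v. \<bar>f v\<bar>)"
    unfolding avg_append unfolding avg_def
    by (simp only: sum_divide_distrib) (subst sum.swap, simp add: mult.commute)
  finally show ?thesis .
qed

text \<open>The numbers a, c and g count the levels above, inside and below the lowest block, and
  \<kappa> is the factor collected by the blocks above. Without such blocks, k = 0 and concavity of
  \<open>level_weight\<close> takes the place of rounding.\<close>

lemma composition_step:
  assumes wf: "query_wf n (a + (c + g)) q" and c: "j \<le> c" and j: "j \<in> {1, 2}"
    and f: "\<And>v. v \<in> sign_strings (a + (c + g)) \<Longrightarrow> f v \<in> {-1, 0, 1}"
    and \<E>: "\<E> \<subseteq> Pow {1..a}" and \<kappa>: "0 \<le> \<kappa>"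
    and IH: "k = 0 \<and> \<E> = {{}} \<and> \<kappa> = 1 \<or> k \<ge> 1 \<and>
      (\<forall>h. (\<forall>v\<in>sign_strings a. h v \<in> {-1, 0, 1}) \<longrightarrow>
        fourier_norm n (tree_poly q a h \<E>) \<le> \<kappa> * Lambda (n\<^sup>2) k (avg a (\<lambda>v. \<bar>h v\<bar>)))"
  shows "fourier_norm n (tree_poly q (a + (c + g)) f
      (family_join \<E> ((`) ((+) a) ` subsets_of_size {1..c} j)))
    \<le> \<kappa> * (sqrt (real (c choose j)) * C ^ j) * 12 ^ j
      * Lambda (n\<^sup>2) (k + j) (avg (a + (c + g)) (\<lambda>v. \<bar>f v\<bar>))"
proof -
  define \<F> where "\<F> = subsets_of_size {1..c} j"
  define e where "e = c + g"
  define D where "D = sqrt (real (c choose j)) * C ^ j"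
  define G where "G u = tree_poly (\<lambda>w. q (u @ w)) e (\<lambda>w. f (u @ w)) \<F>" for u
  define \<alpha> where "\<alpha> u = avg e (\<lambda>w. \<bar>f (u @ w)\<bar>)" for u
  define p where "p = avg (a + e) (\<lambda>v. \<bar>f v\<bar>)"
  have n2: "n\<^sup>2 \<ge> 1" using n_ge_1 by simp
  have \<F>: "\<F> \<subseteq> Pow {1..c}" by (auto simp: \<F>_def subsets_of_size_def)
  have "0 < real (c choose j)" using c by simp
  then have D: "0 < D" unfolding D_def using C_ge_1 by simp
  have f': "f (u @ w) \<in> {-1, 0, 1}" if "u \<in> sign_strings a" "w \<in> sign_strings e" for u w
    using f append_sign_strings[OF that] by (simp add: e_def)
  have \<alpha>: "0 \<le> \<alpha> u \<and> \<alpha> u \<le> 1" if "u \<in> sign_strings a" for u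
  proof -
    have "\<bar>f (u @ w)\<bar> \<le> 1" if "w \<in> sign_strings e" for w
      using f'[OF \<open>u \<in> sign_strings a\<close> that] by auto
    then have "\<alpha> u \<le> avg e (\<lambda>_. 1)" unfolding \<alpha>_def by (intro avg_mono)
    then show ?thesis by (simp add: \<alpha>_def avg_nonneg)
  qed
  have p_alt: "avg a \<alpha> = p" unfolding p_def \<alpha>_def avg_append ..
  have p0: "0 \<le> p" unfolding p_def by (intro avg_nonneg) simp
  have "avg a \<alpha> \<le> avg a (\<lambda>_. 1)" using \<alpha> by (intro avg_mono) simp
  then have p1: "p \<le> 1" by (simp add: p_alt)
  have wfu: "query_wf n e (\<lambda>w. q (u @ w))" if "u \<in> sign_strings a" for u
    using wf that unfolding e_def by (rule query_wf_subtree)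
  have G: "fourier_norm n (G u) \<le> D * level_weight n j (\<alpha> u)" if "u \<in> sign_strings a" for u
    unfolding G_def \<F>_def D_def \<alpha>_def e_def
    using wfu[OF that] f'[OF that] c j unfolding e_def
    by (intro level_estimate_truncated) auto
  have split: "tree_poly q (a + e) f (family_join \<E> ((`) ((+) a) ` \<F>)) x
      = (\<Sum>A\<in>\<E>. avg a (\<lambda>u. (\<Prod>i\<in>A. u ! (i - 1) * x (q (take (i - 1) u))) * G u x))" for x
    unfolding G_def by (rule tree_poly_split_levels[OF \<E> \<F>])
  have "fourier_norm n (tree_poly q (a + e) f (family_join \<E> ((`) ((+) a) ` \<F>)))
      \<le> \<kappa> * D * 12 ^ j * Lambda (n\<^sup>2) (k + j) p"
    using IH
  proof (elim disjE conjE)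
    assume base: "k = 0" "\<E> = {{}}" "\<kappa> = 1"
    have "fourier_norm n (tree_poly q (a + e) f (family_join \<E> ((`) ((+) a) ` \<F>)))
        = fourier_norm n (\<lambda>x. avg a (\<lambda>u. G u x))"
      by (intro fourier_norm_cong, subst split) (simp add: base(2))
    also have "\<dots> \<le> avg a (\<lambda>u. fourier_norm n (G u))"
      by (rule fourier_norm_avg_le)
    also have "\<dots> \<le> avg a (\<lambda>u. D * level_weight n j (\<alpha> u))"
      by (intro avg_mono G)
    also have "\<dots> \<le> D * level_weight n j p"
      unfolding avg_cmult p_alt[symmetric] using D
      by (intro mult_left_mono level_weight_avg_le n_ge_1 j \<alpha>) auto
    also have "\<dots> \<le> D * (12 ^ j * Lambda (n\<^sup>2) j p)"
      using D by (intro mult_left_mono level_weight_le_Lambda n_ge_1 j p0 p1) auto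
    finally show ?thesis using base by (simp add: mult.assoc)
  next
    assume k: "k \<ge> 1" and
      IH: "\<forall>h. (\<forall>v\<in>sign_strings a. h v \<in> {-1, 0, 1}) \<longrightarrow>
        fourier_norm n (tree_poly q a h \<E>) \<le> \<kappa> * Lambda (n\<^sup>2) k (avg a (\<lambda>v. \<bar>h v\<bar>))"
    let ?\<nu> = "\<lambda>h. fourier_norm n (tree_poly q a h \<E>)"
    let ?A = "subsets_of_size {1..n} j"
    \<comment> \<open>For fixed U these coefficients form a real labelling of the tree cut at level
      a; homogeneity of G u leaves only sets U of size j.\<close>
    define H where "H u U = fourier_coeff n (G u) U" for u U
    have G_expand: "G u x = (\<Sum>U\<in>?A. H u U * (\<Prod>i\<in>U. x i))"
      if "u \<in> sign_strings a" "x \<in> hypercube n" for u x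
    proof -
      have "G u x = (\<Sum>U\<in>Pow {1..n}. H u U * (\<Prod>i\<in>U. x i))"
        unfolding H_def by (rule fourier_inversion[OF that(2)])
      also have "\<dots> = (\<Sum>U\<in>?A. H u U * (\<Prod>i\<in>U. x i))"
      proof (rule sum.mono_neutral_right)
        show "\<forall>U\<in>Pow {1..n} - ?A. H u U * (\<Prod>i\<in>U. x i) = 0"
        proof
          fix U assume U: "U \<in> Pow {1..n} - ?A"
          then have "finite U" using finite_subset by blast
          then have "card U \<noteq> j" using U by (auto simp: subsets_of_size_def)
          moreover have "\<F> \<subseteq> subsets_of_size {1..e} j"
            by (auto simp: \<F>_def subsets_of_size_def e_def)
          ultimately have "H u U = 0"
            unfolding H_def G_def
            using fourier_coeff_tree_poly_eq_0[OF wfu[OF that(1)]] U by blast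
          then show "H u U * (\<Prod>i\<in>U. x i) = 0" by simp
        qed
      qed (auto simp: subsets_of_size_def)
      finally show ?thesis .
    qed
    have "fourier_norm n (tree_poly q (a + e) f (family_join \<E> ((`) ((+) a) ` \<F>)))
        = fourier_norm n (\<lambda>x. \<Sum>U\<in>?A. (\<Prod>i\<in>U. x i) * tree_poly q a (\<lambda>u. H u U) \<E> x)"
    proof (rule fourier_norm_cong)
      fix x assume x: "x \<in> hypercube n"
      have "tree_poly q (a + e) f (family_join \<E> ((`) ((+) a) ` \<F>)) x
          = (\<Sum>A\<in>\<E>. avg a (\<lambda>u. \<Sum>U\<in>?A. (\<Prod>i\<in>U. x i) *
              (H u U * (\<Prod>i\<in>A. u ! (i - 1) * x (q (take (i - 1) u))))))"
        unfolding split
        by (intro sum.cong refl avg_cong) (simp add: G_expand[OF _ x] sum_distrib_left sum_distrib_right mult_ac)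
      also have "\<dots> = (\<Sum>U\<in>?A. \<Sum>A\<in>\<E>. avg a (\<lambda>u. (\<Prod>i\<in>U. x i) *
              (H u U * (\<Prod>i\<in>A. u ! (i - 1) * x (q (take (i - 1) u))))))"
        by (subst sum.swap) (simp only: avg_sum)
      also have "\<dots> = (\<Sum>U\<in>?A. (\<Prod>i\<in>U. x i) * tree_poly q a (\<lambda>u. H u U) \<E> x)"
        by (simp only: avg_cmult tree_poly_def sum_distrib_left)
      finally show "tree_poly q (a + e) f (family_join \<E> ((`) ((+) a) ` \<F>)) x
          = (\<Sum>U\<in>?A. (\<Prod>i\<in>U. x i) * tree_poly q a (\<lambda>u. H u U) \<E> x)" .
    qed
    also have "\<dots> \<le> (\<Sum>U\<in>?A. fourier_norm n (\<lambda>x. (\<Prod>i\<in>U. x i) * tree_poly q a (\<lambda>u. H u U) \<E> x))"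
      by (rule fourier_norm_sum_le)
    also have "\<dots> \<le> (\<Sum>U\<in>?A. ?\<nu> (\<lambda>u. H u U))"
      by (intro sum_mono fourier_norm_character_mult_le) (simp add: subsets_of_size_def)
    also have "\<dots> \<le> \<kappa> * D * 12 ^ j * Lambda (n\<^sup>2) (k + j) p"
    proof (cases "p = 0")
      case True
      have "H u U = 0" if "u \<in> sign_strings a" for u U
      proof -
        have "\<alpha> u = 0" using avg_eq_0D[of a \<alpha> u] True p_alt \<alpha> that by simp
        then have "f (u @ w) = 0" if "w \<in> sign_strings e" for w
          using avg_eq_0D[of e "\<lambda>w. \<bar>f (u @ w)\<bar>" w] that by (simp add: \<alpha>_def)
        then have "G u x = 0" for x
          unfolding G_def tree_poly_def by (intro sum.neutral ballI) (simp cong: avg_cong)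
        then show ?thesis by (simp add: H_def fourier_coeff_def)
      qed
      then have "?\<nu> (\<lambda>u. H u U) = ?\<nu> (\<lambda>u. 0 * H u U)" for U
        by (intro string_seminormD(3)[OF string_seminorm_tree_poly]) simp
      then have "?\<nu> (\<lambda>u. H u U) = 0" for U
        unfolding string_seminormD(2)[OF string_seminorm_tree_poly] by simp
      then show ?thesis using True by (simp add: Lambda_def)
    next
      case False
      \<comment> \<open>The place where n^2 arises, as a common bound for n choose 1 and n choose
        2.\<close>
      have card: "card ?A \<le> n\<^sup>2"
      proof (cases "j \<le> n")
        case True
        then have "n choose j \<le> n ^ j" by (rule binomial_le_pow)
        also have "\<dots> \<le> n\<^sup>2" using j n_ge_1 by (intro power_increasing) auto
        finally show ?thesis by (simp add: card_subsets_of_size)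
      qed (simp add: card_subsets_of_size binomial_eq_0)
      show ?thesis
        unfolding p_alt[symmetric]
      proof (rule seminorm_composition[OF string_seminorm_tree_poly _ card n_ge_1 k j \<kappa> _ \<alpha> D])
        fix h :: "real list \<Rightarrow> real"
        assume h: "\<And>v. v \<in> sign_strings a \<Longrightarrow> h v \<in> {-1, 0, 1}"
        then have "\<bar>h v\<bar> \<le> 1" if "v \<in> sign_strings a" for v using that by fastforce
        then have "avg a (\<lambda>v. \<bar>h v\<bar>) \<le> avg a (\<lambda>_. 1)" by (intro avg_mono)
        \<comment> \<open>Rounding needs a supported bound, so the induction hypothesis is weakened
          to the envelope; the composition returns to \<open>Lambda\<close>.\<close>
        then have "Lambda (n\<^sup>2) k (avg a (\<lambda>v. \<bar>h v\<bar>)) \<le> Lambda_env (n\<^sup>2) k (avg a (\<lambda>v. \<bar>h v\<bar>))"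
          by (intro Lambda_le_env n2 k avg_nonneg) auto
        then have "\<kappa> * Lambda (n\<^sup>2) k (avg a (\<lambda>v. \<bar>h v\<bar>)) \<le> \<kappa> * Lambda_env (n\<^sup>2) k (avg a (\<lambda>v. \<bar>h v\<bar>))"
          using \<kappa> by (rule mult_left_mono)
        moreover have "?\<nu> h \<le> \<kappa> * Lambda (n\<^sup>2) k (avg a (\<lambda>v. \<bar>h v\<bar>))" using IH h by blast
        ultimately show "?\<nu> h \<le> \<kappa> * Lambda_env (n\<^sup>2) k (avg a (\<lambda>v. \<bar>h v\<bar>))" by linarith
      next
        fix u assume u: "u \<in> sign_strings a"
        have "(\<Sum>U\<in>?A. \<bar>H u U\<bar>) \<le> fourier_norm n (G u)"
          unfolding fourier_norm_def H_def by (rule sum_mono2) (auto simp: subsets_of_size_def)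
        then show "(\<Sum>U\<in>?A. \<bar>H u U\<bar>) \<le> D * level_weight n j (\<alpha> u)" using G[OF u] by linarith
      next
        show "0 < avg a \<alpha>" using False p0 by (simp add: p_alt)
      qed simp
    qed
    finally show ?thesis .
  qed
  then show ?thesis unfolding \<F>_def e_def D_def p_def .
qed

end

section \<open>Elementary families\<close>

text \<open>Order-free description of a join of families of subsets of disjoint blocks.\<close>

definition block_family :: "('i \<Rightarrow> nat set) \<Rightarrow> ('i \<Rightarrow> nat) \<Rightarrow> 'i set \<Rightarrow> nat set set" where
  "block_family I k J = {A. A \<subseteq> (\<Union>i\<in>J. I i) \<and> (\<forall>i\<in>J. card (A \<inter> I i) = k i)}"

lemma block_family_empty [simp]: "block_family I k {} = {{}}"
  by (auto simp: block_family_def)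

lemma family_join_commute: "family_join \<A> \<B> = family_join \<B> \<A>"
  unfolding family_join_def by (auto simp: Un_commute)

lemma block_family_insert:
  assumes "finite (I x)" "I x \<inter> (\<Union>i\<in>J. I i) = {}"
  shows "block_family I k (insert x J) = family_join (block_family I k J) (subsets_of_size (I x) (k x))"
proof (intro set_eqI iffI)
  fix S assume S: "S \<in> block_family I k (insert x J)"
  let ?A = "S \<inter> (\<Union>i\<in>J. I i)" and ?B = "S \<inter> I x"
  have "?A \<inter> I i = S \<inter> I i" if "i \<in> J" for i using that by blast
  then have "?A \<in> block_family I k J" using S by (auto simp: block_family_def)
  moreover have "?B \<in> subsets_of_size (I x) (k x)"
    using S assms(1) by (auto simp: block_family_def subsets_of_size_def)
  moreover have "S = ?A \<union> ?B" using S by (auto simp: block_family_def)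
  ultimately show "S \<in> family_join (block_family I k J) (subsets_of_size (I x) (k x))"
    unfolding family_join_def by blast
next
  fix S assume "S \<in> family_join (block_family I k J) (subsets_of_size (I x) (k x))"
  then obtain A B where S: "S = A \<union> B" and A: "A \<in> block_family I k J"
    and B: "B \<in> subsets_of_size (I x) (k x)" unfolding family_join_def by blast
  have sub: "A \<subseteq> (\<Union>i\<in>J. I i)" "B \<subseteq> I x"
    using A B by (auto simp: block_family_def subsets_of_size_def)
  have "S \<inter> I x = B" using sub assms(2) unfolding S by blast
  moreover have "S \<inter> I i = A \<inter> I i" if "i \<in> J" for i using sub assms(2) that unfolding S by blast
  moreover have "S \<subseteq> (\<Union>i\<in>insert x J. I i)" using sub unfolding S by blast
  ultimately show "S \<in> block_family I k (insert x J)"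
    using A B by (simp add: block_family_def subsets_of_size_def)
qed

lemma foldr_family_join_eq_block_family:
  assumes "distinct xs" "disjoint_family_on I (set xs)" "\<And>i. i \<in> set xs \<Longrightarrow> finite (I i)"
  shows "foldr family_join (map (\<lambda>j. subsets_of_size (I j) (k j)) xs) {{}} = block_family I k (set xs)"
  using assms
proof (induction xs)
  case (Cons x xs)
  have "I x \<inter> (\<Union>i\<in>set xs. I i) = {}"
    using Cons.prems(1,2) by (auto simp: disjoint_family_on_def)
  moreover have "disjoint_family_on I (set xs)"
    using Cons.prems(2) by (rule disjoint_family_on_mono[rotated]) auto
  ultimately show ?case
    using Cons by (simp add: block_family_insert family_join_commute)
qed simp

text \<open>A block of size 0 only forces an empty intersection, which disjointness from the other
  blocks guarantees. The remaining sizes are 1 and 2, those of the level estimates.\<close>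

lemma block_family_remove_zeros:
  assumes "disjoint_family_on I J" "\<And>i. i \<in> J \<Longrightarrow> finite (I i)"
  shows "block_family I k J = block_family I k {i \<in> J. k i \<noteq> 0}"
proof (intro set_eqI iffI)
  fix A assume A: "A \<in> block_family I k J"
  have "A \<inter> I i = {}" if "i \<in> J" "k i = 0" for i
  proof -
    have "card (A \<inter> I i) = 0" using A that by (simp add: block_family_def)
    then show ?thesis using assms(2)[OF that(1)] by simp
  qed
  then have "A \<subseteq> (\<Union>i\<in>{i \<in> J. k i \<noteq> 0}. I i)" using A unfolding block_family_def by blast
  then show "A \<in> block_family I k {i \<in> J. k i \<noteq> 0}" using A by (simp add: block_family_def)
next
  fix A assume A: "A \<in> block_family I k {i \<in> J. k i \<noteq> 0}"
  have "A \<inter> I i = {}" if "i \<in> J" "k i = 0" for i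
  proof -
    have "I i' \<inter> I i = {}" if "i' \<in> {i \<in> J. k i \<noteq> 0}" for i'
    proof -
      have "i' \<in> J" "i' \<noteq> i" using that \<open>k i = 0\<close> by auto
      then show ?thesis using assms(1) \<open>i \<in> J\<close> unfolding disjoint_family_on_def by blast
    qed
    moreover have "A \<subseteq> (\<Union>i\<in>{i \<in> J. k i \<noteq> 0}. I i)" using A by (simp add: block_family_def)
    ultimately show ?thesis by blast
  qed
  then have "card (A \<inter> I i) = k i" if "i \<in> J" for i
    using A that by (cases "k i = 0") (auto simp: block_family_def)
  moreover have "A \<subseteq> (\<Union>i\<in>J. I i)" using A unfolding block_family_def by blast
  ultimately show "A \<in> block_family I k J" by (simp add: block_family_def)
qed

lemma card_block_family_member:
  assumes "finite J" "disjoint_family_on I J" "\<And>i. i \<in> J \<Longrightarrow> finite (I i)" "A \<in> block_family I k J"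
  shows "card A = (\<Sum>i\<in>J. k i)"
proof -
  have "A = (\<Union>i\<in>J. A \<inter> I i)" using assms(4) by (auto simp: block_family_def)
  also have "card \<dots> = (\<Sum>i\<in>J. card (A \<inter> I i))"
    using assms(1-3) by (intro card_UN_disjoint) (auto simp: disjoint_family_on_def)
  also have "\<dots> = (\<Sum>i\<in>J. k i)" using assms(4) by (simp add: block_family_def)
  finally show ?thesis .
qed

text \<open>Exchanging an element of A in the block for y keeps all intersection sizes. It is used
  to show that the intervals of a nonempty family within 1, ..., d lie within 1, ..., d
  themselves.\<close>

lemma block_family_covers:
  assumes "disjoint_family_on I J" "\<And>i. i \<in> J \<Longrightarrow> finite (I i)" "A \<in> block_family I k J"
    and "i \<in> J" "k i \<noteq> 0" "y \<in> I i"
  shows "\<exists>A'\<in>block_family I k J. y \<in> A'"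
proof (cases "y \<in> A")
  case False
  have "card (A \<inter> I i) \<noteq> 0" using assms(3-5) by (simp add: block_family_def)
  then have "A \<inter> I i \<noteq> {}" by (metis card.empty)
  then obtain b where b: "b \<in> A" "b \<in> I i" by blast
  define A' where "A' = insert y (A - {b})"
  have "A' \<inter> I i = insert y ((A \<inter> I i) - {b})" using assms(6) unfolding A'_def by blast
  moreover have "y \<notin> (A \<inter> I i) - {b}" "finite ((A \<inter> I i) - {b})" using False assms(2,4) by auto
  moreover have "card (A \<inter> I i) = Suc (card ((A \<inter> I i) - {b}))"
    using b assms(2,4) by (intro card.remove) auto
  ultimately have "card (A' \<inter> I i) = card (A \<inter> I i)" by simp
  moreover have "A' \<inter> I i' = A \<inter> I i'" if "i' \<in> J" "i' \<noteq> i" for i'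
  proof -
    have "I i' \<inter> I i = {}" using assms(1,4) that unfolding disjoint_family_on_def by blast
    then show ?thesis using b assms(6) unfolding A'_def by blast
  qed
  ultimately have "card (A' \<inter> I i') = k i'" if "i' \<in> J" for i'
    using assms(3) that by (cases "i' = i") (auto simp: block_family_def)
  moreover have "A' \<subseteq> (\<Union>i\<in>J. I i)"
    using assms(3,4,6) unfolding A'_def block_family_def by blast
  ultimately have "A' \<in> block_family I k J" by (simp add: block_family_def)
  then show ?thesis unfolding A'_def by blast
qed (use assms(3) in blast)

section \<open>Blocks as shifted families and the induction over blocks\<close>

lemma subsets_of_size_shift:
  "subsets_of_size ((+) a ` S) j = (`) ((+) a) ` subsets_of_size S j" for a :: nat
proof (intro set_eqI iffI)
  fix B assume B: "B \<in> subsets_of_size ((+) a ` S) j"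
  then obtain B0 where B0: "B0 \<subseteq> S" "B = (+) a ` B0"
    unfolding subsets_of_size_def by (auto simp: subset_image_iff)
  moreover have "card B = card B0" "finite B0"
    using B B0 finite_imageD[of "(+) a" B0] by (auto simp: card_image subsets_of_size_def)
  ultimately show "B \<in> (`) ((+) a) ` subsets_of_size S j"
    using B by (auto simp: subsets_of_size_def)
next
  fix B assume "B \<in> (`) ((+) a) ` subsets_of_size S j"
  then show "B \<in> subsets_of_size ((+) a ` S) j"
    by (auto simp: subsets_of_size_def card_image)
qed

lemma card_shifted_join:
  fixes a c :: nat
  assumes "\<E> \<subseteq> Pow {1..a}" "\<F> \<subseteq> Pow {1..c}"
  shows "card (family_join \<E> ((`) ((+) a) ` \<F>)) = card \<E> * card \<F>"
  unfolding shifted_join_image using card_image[OF shifted_join_inj[OF assms]]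
  by (simp add: card_cartesian_product)

text \<open>Induction on the number of blocks, with varying depth and labels: removing the lowest
  block leaves a tree truncated just above it. The cardinality of the family factors along the same
  splitting.\<close>

lemma (in level_estimate) block_family_bound:
  assumes "finite J" "disjoint_family_on I J" "J \<noteq> {}"
    and "\<And>i. i \<in> J \<Longrightarrow> is_interval_nat (I i) \<and> I i \<subseteq> {1..d} \<and> k i \<in> {1, 2} \<and> k i \<le> card (I i)"
    and "query_wf n d q" "\<And>v. v \<in> sign_strings d \<Longrightarrow> f v \<in> {-1, 0, 1}"
  shows "fourier_norm n (tree_poly q d f (block_family I k J))
    \<le> (12 * C) ^ (\<Sum>i\<in>J. k i) * sqrt (real (card (block_family I k J)))
      * Lambda (n\<^sup>2) (\<Sum>i\<in>J. k i) (avg d (\<lambda>v. \<bar>f v\<bar>))"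
  using assms
proof (induction "card J" arbitrary: J d f rule: less_induct)
  case less
  have blk: "is_interval_nat (I i)" "I i \<subseteq> {1..d}" "k i \<in> {1, 2}" "k i \<le> card (I i)" "I i \<noteq> {}"
    if "i \<in> J" for i
    using less.prems(4)[OF that] by auto
  have "Max ((\<lambda>i. Min (I i)) ` J) \<in> (\<lambda>i. Min (I i)) ` J"
    using less.prems(1,3) by (intro Max_in) auto
  then obtain x where x: "x \<in> J" and "Max ((\<lambda>i. Min (I i)) ` J) = Min (I x)" by blast
  then have x_max: "Min (I i) \<le> Min (I x)" if "i \<in> J" for i
    using Max_ge[of "(\<lambda>i. Min (I i)) ` J" "Min (I i)"] less.prems(1) that by simp
  obtain lo hi where Ix: "I x = {lo..hi}" using blk(1)[OF x] by (auto simp: is_interval_nat_def)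
  have lohi: "lo \<le> hi" "1 \<le> lo" "hi \<le> d" using blk(2,5)[OF x] unfolding Ix by auto
  \<comment> \<open>The variable of level i is queried at a string of length i - 1, so the subtrees
    that contain the block are rooted at strings of length lo - 1.\<close>
  define a where "a = lo - 1"
  define c where "c = hi - a"
  define g where "g = d - hi"
  have d: "d = a + (c + g)" using lohi by (simp add: a_def c_def g_def)
  have Ix': "I x = (+) a ` {1..c}" unfolding Ix image_add_atLeastAtMost using lohi by (simp add: a_def c_def)
  define J' where "J' = J - {x}"
  define \<E> where "\<E> = block_family I k J'"
  have J: "J = insert x J'" "x \<notin> J'" "finite J'" using x less.prems(1) by (auto simp: J'_def)
  have below: "I i \<subseteq> {1..a}" if "i \<in> J'" for i
  proof -
    have i: "i \<in> J" "i \<noteq> x" using that by (auto simp: J'_def)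
    obtain l h where Ii: "I i = {l..h}" using blk(1)[OF i(1)] by (auto simp: is_interval_nat_def)
    then have lh: "l \<le> h" "1 \<le> l" using blk(2,5)[OF i(1)] by auto
    have "Min (I i) = l" "Min (I x) = lo" using lh lohi unfolding Ii Ix by (auto intro!: Min_eqI)
    then have "l \<le> lo" using x_max[OF i(1)] by simp
    \<comment> \<open>An interval that starts at or before lo and avoids lo has to end before
      it.\<close>
    moreover have "lo \<notin> I i"
    proof -
      have "I i \<inter> I x = {}" using less.prems(2) i x unfolding disjoint_family_on_def by blast
      moreover have "lo \<in> I x" using lohi unfolding Ix by simp
      ultimately show ?thesis by blast
    qed
    ultimately show ?thesis using lh lohi unfolding Ii by (auto simp: a_def)
  qed
  have \<E>: "\<E> \<subseteq> Pow {1..a}" using below unfolding \<E>_def block_family_def by blast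
  have "finite (I x)" unfolding Ix by simp
  moreover have "I x \<inter> (\<Union>i\<in>J'. I i) = {}"
    using less.prems(2) x unfolding disjoint_family_on_def J'_def by blast
  ultimately have fam: "block_family I k J
      = family_join \<E> ((`) ((+) a) ` subsets_of_size {1..c} (k x))"
    unfolding \<E>_def J(1) by (simp only: block_family_insert Ix' subsets_of_size_shift)
  have kc: "k x \<le> c" using blk(4)[OF x] unfolding Ix' by (simp add: card_image)
  have "card (block_family I k J) = card \<E> * (c choose k x)"
    unfolding fam using card_shifted_join[OF \<E>, of "subsets_of_size {1..c} (k x)" c]
    by (simp add: card_subsets_of_size) (auto simp: subsets_of_size_def)
  then have card: "sqrt (real (card (block_family I k J))) = sqrt (real (card \<E>)) * sqrt (real (c choose k x))"
    by (simp add: real_sqrt_mult)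
  define K where "K = (\<Sum>i\<in>J'. k i)"
  define \<kappa> where "\<kappa> = (12 * C) ^ K * sqrt (real (card \<E>))"
  have K: "(\<Sum>i\<in>J. k i) = K + k x" unfolding K_def J(1) using J(2,3) by simp
  have \<kappa>0: "0 \<le> \<kappa>" unfolding \<kappa>_def using C_ge_1 by simp
  have "K = 0 \<and> \<E> = {{}} \<and> \<kappa> = 1 \<or> K \<ge> 1 \<and>
      (\<forall>h. (\<forall>v\<in>sign_strings a. h v \<in> {-1, 0, 1}) \<longrightarrow>
        fourier_norm n (tree_poly q a h \<E>) \<le> \<kappa> * Lambda (n\<^sup>2) K (avg a (\<lambda>v. \<bar>h v\<bar>)))"
  proof (cases "J' = {}")
    case True
    then have "K = 0" "\<E> = {{}}" by (auto simp: K_def \<E>_def)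
    then show ?thesis by (simp add: \<kappa>_def)
  next
    case False
    then obtain i where i: "i \<in> J'" by blast
    then have "1 \<le> k i" using blk(3)[of i] by (auto simp: J'_def)
    also have "k i \<le> K" unfolding K_def using i J(3) by (intro member_le_sum) auto
    finally have "K \<ge> 1" .
    moreover have "fourier_norm n (tree_poly q a h \<E>) \<le> \<kappa> * Lambda (n\<^sup>2) K (avg a (\<lambda>v. \<bar>h v\<bar>))"
      if h: "\<forall>v\<in>sign_strings a. h v \<in> {-1, 0, 1}" for h
      unfolding \<E>_def K_def \<kappa>_def
    proof (rule less.hyps)
      show "card J' < card J" using J by simp
      show "disjoint_family_on I J'"
        using less.prems(2) by (rule disjoint_family_on_mono[rotated]) (auto simp: J'_def)
      show "query_wf n a q" using query_wf_prefix[OF less.prems(5)] d by simp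
      show "is_interval_nat (I i) \<and> I i \<subseteq> {1..a} \<and> k i \<in> {1, 2} \<and> k i \<le> card (I i)" if "i \<in> J'" for i
        using blk[of i] below[OF that] that by (simp add: J'_def)
    qed (use False J(3) h in auto)
    ultimately show ?thesis by blast
  qed
  then have "fourier_norm n (tree_poly q (a + (c + g)) f
      (family_join \<E> ((`) ((+) a) ` subsets_of_size {1..c} (k x))))
    \<le> \<kappa> * (sqrt (real (c choose k x)) * C ^ k x) * 12 ^ k x
      * Lambda (n\<^sup>2) (K + k x) (avg (a + (c + g)) (\<lambda>v. \<bar>f v\<bar>))"
    using less.prems(5,6) kc blk(3)[OF x] \<E> \<kappa>0 unfolding d by (intro composition_step) auto
  also have "\<kappa> * (sqrt (real (c choose k x)) * C ^ k x) * 12 ^ k x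
      = (12 * C) ^ (K + k x) * sqrt (real (card (block_family I k J)))"
    unfolding card \<kappa>_def by (simp add: power_add power_mult_distrib)
  finally show ?case unfolding fam[symmetric] d[symmetric] K .
qed

theorem theorem4p10:
  fixes C p :: real and n d k :: nat and T :: dtree and \<E> :: "nat set set"
  assumes "C \<ge> 1"
    and level_bounds: "\<And>(n'::nat) (d'::nat) (g :: (nat \<Rightarrow> real) \<Rightarrow> real) (q::real).
      \<lbrakk> n' \<ge> 1; d' \<ge> 1; \<forall>x\<in>hypercube n'. g x \<in> {-1, 0, 1}; \<exists>x\<in>hypercube n'. g x \<noteq> 0;
        dtree_computable n' d' g; q = prob_nonzero n' g \<rbrakk> \<Longrightarrow>
      fourier_norm n' (fourier_level n' 1 g)
        \<le> sqrt (real (d' choose 1)) * C * q * sqrt (ln (exp 1 / q)) \<and>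
      fourier_norm n' (fourier_level n' 2 g)
        \<le> sqrt (real (d' choose 2)) * C\<^sup>2 * q * sqrt (ln (exp 1 / q))
            * sqrt (ln (exp 1 * real n' / q))"
    and "n \<ge> 1" and "d \<ge> 1" and "0 \<le> p" and "p \<le> 1"
    and "T \<in> trees_star_0 n d p"
    and "1 \<le> k" and "k \<le> d"
    and "elementary_family \<E>" and "\<E> \<subseteq> subsets_of_size {1..d} k"
  shows "fourier_norm n (tree_restrict n d T \<E>)
           \<le> (12 * C) ^ k * Lambda (n\<^sup>2) k p * sqrt (real (card \<E>))"
proof -
  have mlpoly_eval_const: "mlpoly_eval n (mlpoly_const c) x = c" for c x
    by (simp add: mlpoly_eval_def mlpoly_const_def if_distrib[of "\<lambda>c. c * _"] cong: if_cong)
  interpret level_estimate C n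
  proof
    show "C \<ge> 1" "n \<ge> 1" by fact+
    fix d q j and f :: "real list \<Rightarrow> real"
    assume wf: "query_wf n d q" and d: "d \<ge> 1" and j: "j \<in> {1, 2::nat}"
      and f: "\<And>v. v \<in> sign_strings d \<Longrightarrow> f v \<in> {-1, 0, 1}"
    let ?g = "tree_poly q d f (Pow {1..d})"
    define a where "a = avg d (\<lambda>v. \<bar>f v\<bar>)"
    have prob: "prob_nonzero n ?g = a" unfolding a_def using wf f by (rule prob_nonzero_tree_poly)
    have level: "fourier_norm n (fourier_level n j ?g)
        = fourier_norm n (tree_poly q d f (subsets_of_size {1..d} j))"
      by (intro fourier_norm_cong fourier_level_tree_poly wf)
    show "fourier_norm n (tree_poly q d f (subsets_of_size {1..d} j))
        \<le> sqrt (real (d choose j)) * C ^ j * level_weight n j (avg d (\<lambda>v. \<bar>f v\<bar>))"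
    proof (cases "\<exists>x\<in>hypercube n. ?g x \<noteq> 0")
      case True
      have "?g x \<in> {-1, 0, 1}" if x: "x \<in> hypercube n" for x
      proof -
        obtain v where v: "v \<in> sign_strings d" "\<forall>i<d. v ! i = x (q (take i v))"
          using ex_path[OF x wf] by blast
        show ?thesis unfolding tree_poly_Pow_eval[OF x wf v] by (rule f[OF v(1)])
      qed
      then have "fourier_norm n (fourier_level n 1 ?g)
          \<le> sqrt (real (d choose 1)) * C * a * sqrt (ln (exp 1 / a))"
        "fourier_norm n (fourier_level n 2 ?g)
          \<le> sqrt (real (d choose 2)) * C\<^sup>2 * a * sqrt (ln (exp 1 / a)) * sqrt (ln (exp 1 * real n / a))"
        using level_bounds[OF \<open>n \<ge> 1\<close> d _ True dtree_computable_tree_poly[OF wf] prob[symmetric]] by auto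
      then show ?thesis
        using j level by (auto simp: level_weight_def a_def mult.assoc)
    next
      case False
      \<comment> \<open>The hypotheses exclude the zero function; in that case all labels vanish and
        both sides are 0.\<close>
      then have "a = 0" unfolding prob[symmetric] prob_nonzero_def
        by (auto simp: card_eq_0_iff)
      then have "\<bar>f v\<bar> = 0" if "v \<in> sign_strings d" for v
        using avg_eq_0D[of d "\<lambda>v. \<bar>f v\<bar>" v] that by (simp add: a_def)
      then have "tree_poly q d f (subsets_of_size {1..d} j) = (\<lambda>x. 0)"
        unfolding tree_poly_def by (intro ext sum.neutral ballI) (simp cong: avg_cong)
      then show ?thesis
        using \<open>a = 0\<close> by (simp add: a_def[symmetric] fourier_norm_def fourier_coeff_def)
    qed
  qed
  define f where "f v = leaf T v {}" for v
  have T: "decision_tree n d T" "tree_density d T = p"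
    and leaf_in: "\<And>v. v \<in> sign_strings d \<Longrightarrow> leaf T v \<in> mlpoly_const ` {-1, 0, 1}"
    using assms(7) by (auto simp: trees_star_0_def)
  have leaf: "leaf T v = mlpoly_const (f v)" "f v \<in> {-1, 0, 1}" if "v \<in> sign_strings d" for v
    using leaf_in[OF that] by (auto simp: f_def mlpoly_const_def)
  have wf: "query_wf n d (query T)"
    using T(1) unfolding decision_tree_def query_wf_def by blast
  have restrict: "tree_restrict n d T \<E> x = tree_poly (query T) d f \<E> x" for x
    unfolding tree_restrict_def tree_poly_def avg_def
    by (simp add: leaf mlpoly_eval_const sum_divide_distrib cong: sum.cong)
  have dens: "avg d (\<lambda>v. \<bar>f v\<bar>) = p"
  proof -
    have "mlpoly_const a = mlpoly_const b \<longleftrightarrow> a = b" for a b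
      by (metis mlpoly_const_def)
    then have "{v \<in> sign_strings d. leaf T v \<noteq> mlpoly_const 0} = {v \<in> sign_strings d. f v \<noteq> 0}"
      using leaf(1) by auto
    moreover have "(\<Sum>v\<in>sign_strings d. \<bar>f v\<bar>) = (\<Sum>v\<in>sign_strings d. if f v \<noteq> 0 then 1 else 0)"
      using leaf(2) by (intro sum.cong) fastforce+
    ultimately show ?thesis
      using T(2) by (simp add: tree_density_def avg_def card_sign_strings sum.If_cases Int_def)
  qed
  show ?thesis
  proof (cases "\<E> = {}")
    case True
    then show ?thesis
      by (simp add: tree_restrict_def fourier_norm_def fourier_coeff_def)
  next
    case False
    \<comment> \<open>A single member reveals that the sizes add up to k and that every interval is
      large enough for its size.\<close>
    then obtain A where A: "A \<in> \<E>" by blast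
    obtain l I \<kappa> where blocks: "\<And>j. j \<in> {1..l} \<Longrightarrow> is_interval_nat (I j) \<and> \<kappa> j \<in> {0, 1, 2::nat}"
        "disjoint_family_on I {1..l}"
        "\<E> = foldr family_join (map (\<lambda>j. subsets_of_size (I j) (\<kappa> j)) [1..<l + 1]) {{}}"
      using assms(10) unfolding elementary_family_def by metis
    have fin: "finite (I j)" if "j \<in> {1..l}" for j
      using blocks(1)[OF that] by (auto simp: is_interval_nat_def)
    have set: "set [1..<l + 1] = {1..l}" by auto
    define J where "J = {j \<in> {1..l}. \<kappa> j \<noteq> 0}"
    have "\<E> = block_family I \<kappa> {1..l}"
      unfolding blocks(3) set[symmetric] using blocks(2) fin
      by (intro foldr_family_join_eq_block_family) (auto simp: set[simplified])
    also have "\<dots> = block_family I \<kappa> J"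
      unfolding J_def by (rule block_family_remove_zeros[OF blocks(2) fin])
    finally have \<E>: "\<E> = block_family I \<kappa> J" .
    have J: "finite J" "disjoint_family_on I J" "\<And>j. j \<in> J \<Longrightarrow> finite (I j)"
      using blocks(2) fin by (auto simp: J_def intro: disjoint_family_on_mono[rotated])
    have k: "(\<Sum>j\<in>J. \<kappa> j) = k"
      using card_block_family_member[OF J, of A \<kappa>] A assms(11) by (auto simp: \<E> subsets_of_size_def)
    have "J \<noteq> {}" using k assms(8) by auto
    have "fourier_norm n (tree_poly (query T) d f (block_family I \<kappa> J))
        \<le> (12 * C) ^ (\<Sum>j\<in>J. \<kappa> j) * sqrt (real (card (block_family I \<kappa> J)))
          * Lambda (n\<^sup>2) (\<Sum>j\<in>J. \<kappa> j) (avg d (\<lambda>v. \<bar>f v\<bar>))"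
    proof (rule block_family_bound[OF J(1,2) \<open>J \<noteq> {}\<close> _ wf leaf(2)])
      fix j assume j: "j \<in> J"
      have "card (A \<inter> I j) = \<kappa> j" using A j by (simp add: \<E> block_family_def)
      then have "\<kappa> j \<le> card (I j)" using card_mono[OF J(3)[OF j], of "A \<inter> I j"] by simp
      moreover have "I j \<subseteq> {1..d}"
      proof
        fix y assume "y \<in> I j"
        moreover have "\<kappa> j \<noteq> 0" using j by (simp add: J_def)
        ultimately obtain A' where "A' \<in> \<E>" "y \<in> A'"
          using block_family_covers[OF J(2,3), of A \<kappa> j y] A j by (auto simp: \<E>)
        moreover have "A' \<in> subsets_of_size {1..d} k" using assms(11) \<open>A' \<in> \<E>\<close> by blast
        ultimately show "y \<in> {1..d}" by (auto simp: subsets_of_size_def)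
      qed
      ultimately show "is_interval_nat (I j) \<and> I j \<subseteq> {1..d} \<and> \<kappa> j \<in> {1, 2} \<and> \<kappa> j \<le> card (I j)"
        using blocks(1)[of j] j by (auto simp: J_def)
    qed
    then show ?thesis
      unfolding restrict[abs_def] \<E>[symmetric] k dens by (simp add: mult_ac)
  qed
qed

end
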